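(* Let $H$ be a complex Hilbert space, let $\Omega\subset H$ be open and let $u\in\mathcal{PSH}(\Omega)\cap C^2(\Omega)$. If $u$ is maximal in $\Omega$, then \[ \operatorname{FSD}(u)(a)=0\qquad\text{for every }a\in\Omega . \]
   Context: The inner product of $H$ is linear in the first variable. Plurisubharmonic: for $\Omega\subset H$ open, $\mathcal{PSH}(\Omega)$ is the set of upper semicontinuous $u:\Omega\to[-\infty,\infty)$, not identically $-\infty$ on any component of $\Omega$, such that $u(z)\le\frac1{2\pi}\int_0^{2\pi}u(z+e^{i\theta}h)\,d\theta$ whenever $z\in\Omega$, $h\in H$ and $z+\lambda h\in\Omega$ for all $|\lambda|\le1$. Levi form: for $u\in C^2(\Omega)$ with second real Fréchet differential $D^2u(a)$, $4D'D''u(a)(s,t)=D^2u(a)(s,t)+D^2u(a)(is,it)+iD^2u(a)(s,it)-iD^2u(a)(is,t)$; this form is identified with the bounded operator $D'D''u(a)$ on $H$ given by $\langle D'D''u(a)s,t\rangle=D'D''u(a)(s,t)$ (so $D'D''\|z\|^2=I$). For $u$ plurisubharmonic this operator is positive. Maximal: $G\Subset\Omega$ means $G$ is a bounded open set with $\overline G\subset\Omega$ (no compactness of $\overline G$). $u\in\mathcal{PSH}(\Omega)$ is maximal in $\Omega$ if for every bounded open $G\Subset\Omega$ and every $v\in\mathcal{PSH}(G)$ with $\limsup_{z\to\xi}v(z)\le u(\xi)$ for all $\xi\in\partial G$, one has $v\le u$ on $G$. Fujii--Seo determinant: for a bounded positive operator $A\ge0$ and a unit vector $x$, $\Delta_x(A):=\exp\bigl(\lim_{\varepsilon\to0^+}\langle\log(A+\varepsilon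 I)x,x\rangle\bigr)$, with $\exp(-\infty)=0$ (this equals $\exp(\langle(\log A)x,x\rangle)$ if $A$ is invertible). Fujii--Seo determinant density: $\operatorname{FSD}(u)(a):=\inf_{\|x\|=1}\Delta_x(D'D''u(a))$, $a\in\Omega$. *)

theory Defs
  imports "HOL-Analysis.Analysis" "HOL-Computational_Algebra.Polynomial"
begin

section \<open>Complex Hilbert spaces\<close>

text \<open>The underlying real Hilbert space of \<open>H\<close> (norm, topology, Frechet calculus) is the one of
  the library class; its real inner product is the real part of the complex one.\<close>

class complex_hilbert = real_inner + complete_space +
  fixes scaleC :: "complex \<Rightarrow> 'a \<Rightarrow> 'a"  (infixr "*\<^sub>C" 75)
    and cinner :: "'a \<Rightarrow> 'a \<Rightarrow> complex"
  assumes scaleC_add_right: "a *\<^sub>C (x + y) = a *\<^sub>C x + a *\<^sub>C y"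
    and scaleC_add_left: "(a + b) *\<^sub>C x = a *\<^sub>C x + b *\<^sub>C x"
    and scaleC_scaleC: "a *\<^sub>C b *\<^sub>C x = (a * b) *\<^sub>C x"
    and scaleR_eq_scaleC: "r *\<^sub>R x = complex_of_real r *\<^sub>C x"
    and cinner_commute: "cinner x y = cnj (cinner y x)"
    and cinner_add_left: "cinner (x + y) z = cinner x z + cinner y z"
    and cinner_scaleC_left: "cinner (a *\<^sub>C x) y = a * cinner x y"
    and inner_eq_Re_cinner: "inner x y = Re (cinner x y)"

instantiation complex :: complex_hilbert
begin

definition "scaleC_complex (a::complex) (x::complex) = a * x"
definition "cinner_complex (x::complex) (y::complex) = x * cnj y"

instance
  by standard
    (auto simp: scaleC_complex_def cinner_complex_def algebra_simps inner_complex_def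
      scaleR_conv_of_real)

end

lemma cinner_self: "cinner x x = complex_of_real ((norm x)\<^sup>2)" for x :: "'a::complex_hilbert"
proof (rule complex_eqI)
  show "Re (cinner x x) = Re (complex_of_real ((norm x)\<^sup>2))"
    by (simp add: inner_eq_Re_cinner[symmetric] power2_norm_eq_inner)
  have "Im (cinner x x) = - Im (cinner x x)"
    by (subst cinner_commute) simp
  then show "Im (cinner x x) = Im (complex_of_real ((norm x)\<^sup>2))"
    by simp
qed


section \<open>Plurisubharmonic and maximal functions\<close>

definition usc_on :: "'a::topological_space set \<Rightarrow> ('a \<Rightarrow> ereal) \<Rightarrow> bool" where
  "usc_on S u \<longleftrightarrow> (\<forall>c. openin (top_of_set S) {z \<in> S. u z < c})"

text \<open>Lebesgue integral of an extended real function as the difference of the integrals of its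
  positive and negative parts (\<^const>\<open>e2ennreal\<close> sends negative values to \<open>0\<close>). In the
  sub-mean value inequality below the integrand is bounded above, so that \<open>\<infinity> - \<infinity>\<close>
  does not occur.\<close>

definition ereal_integral :: "'b measure \<Rightarrow> ('b \<Rightarrow> ereal) \<Rightarrow> ereal" where
  "ereal_integral M f =
     enn2ereal (\<integral>\<^sup>+ x. e2ennreal (f x) \<partial>M) - enn2ereal (\<integral>\<^sup>+ x. e2ennreal (- f x) \<partial>M)"

text \<open>Functions on \<open>\<Omega>\<close> are total functions whose values outside \<open>\<Omega>\<close> are irrelevant.\<close>

definition psh :: "'a::complex_hilbert set \<Rightarrow> ('a \<Rightarrow> ereal) \<Rightarrow> bool" where
  "psh \<Omega> u \<longleftrightarrow>
     (\<forall>z\<in>\<Omega>. u z < \<infinity>) \<and>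
     usc_on \<Omega> u \<and>
     (\<forall>C\<in>components \<Omega>. \<exists>z\<in>C. u z \<noteq> -\<infinity>) \<and>
     (\<forall>z\<in>\<Omega>. \<forall>h. (\<forall>\<zeta>. cmod \<zeta> \<le> 1 \<longrightarrow> z + \<zeta> *\<^sub>C h \<in> \<Omega>) \<longrightarrow>
        u z \<le> ereal (1 / (2 * pi)) *
          ereal_integral (restrict_space lborel {0..2 * pi}) (\<lambda>\<theta>. u (z + cis \<theta> *\<^sub>C h)))"

definition maximal_psh :: "'a::complex_hilbert set \<Rightarrow> ('a \<Rightarrow> ereal) \<Rightarrow> bool" where
  "maximal_psh \<Omega> u \<longleftrightarrow>
     psh \<Omega> u \<and>
     (\<forall>G v. open G \<and> bounded G \<and> closure G \<subseteq> \<Omega> \<and> psh G v \<and>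
        (\<forall>\<xi>\<in>frontier G. Limsup (at \<xi> within G) v \<le> u \<xi>) \<longrightarrow>
        (\<forall>z\<in>G. v z \<le> u z))"


section \<open>Second derivative and Levi form\<close>

definition D1 :: "('a::real_normed_vector \<Rightarrow> 'b::real_normed_vector) \<Rightarrow> 'a \<Rightarrow> 'a \<Rightarrow>\<^sub>L 'b" where
  "D1 f a = Blinfun (frechet_derivative f (at a))"

definition D2 :: "('a::real_normed_vector \<Rightarrow> 'b::real_normed_vector) \<Rightarrow> 'a \<Rightarrow> 'a \<Rightarrow>\<^sub>L 'a \<Rightarrow>\<^sub>L 'b" where
  "D2 f = D1 (D1 f)"

definition C2_on :: "'a::real_normed_vector set \<Rightarrow> ('a \<Rightarrow> 'b::real_normed_vector) \<Rightarrow> bool" where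
  "C2_on \<Omega> f \<longleftrightarrow>
     (\<forall>z\<in>\<Omega>. f differentiable at z) \<and> (\<forall>z\<in>\<Omega>. D1 f differentiable at z) \<and>
     continuous_on \<Omega> (D2 f)"

definition levi_form :: "('a::complex_hilbert \<Rightarrow> real) \<Rightarrow> 'a \<Rightarrow> 'a \<Rightarrow> 'a \<Rightarrow> complex" where
  "levi_form u a s t =
     (complex_of_real (D2 u a s t) + complex_of_real (D2 u a (\<i> *\<^sub>C s) (\<i> *\<^sub>C t))
       + \<i> * complex_of_real (D2 u a s (\<i> *\<^sub>C t)) - \<i> * complex_of_real (D2 u a (\<i> *\<^sub>C s) t)) / 4"

text \<open>Operators are elements of the library type of bounded real-linear maps. The Levi operator is
  complex linear, because the Levi form is complex linear in its first argument.\<close>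

definition levi_op :: "('a::complex_hilbert \<Rightarrow> real) \<Rightarrow> 'a \<Rightarrow> 'a \<Rightarrow>\<^sub>L 'a" where
  "levi_op u a = (THE A. \<forall>s t. cinner (blinfun_apply A s) t = levi_form u a s t)"


section \<open>Continuous functional calculus and the Fujii--Seo determinant\<close>

definition op_spectrum :: "('a::complex_hilbert \<Rightarrow>\<^sub>L 'a) \<Rightarrow> complex set" where
  "op_spectrum A =
     {\<zeta>. \<nexists>B :: 'a \<Rightarrow>\<^sub>L 'a. \<forall>x. B (A x - \<zeta> *\<^sub>C x) = x \<and> A (B x) - \<zeta> *\<^sub>C B x = x}"

definition poly_op :: "real poly \<Rightarrow> ('a::real_normed_vector \<Rightarrow>\<^sub>L 'a) \<Rightarrow> 'a \<Rightarrow>\<^sub>L 'a" where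
  "poly_op p A = (\<Sum>i\<le>degree p. coeff p i *\<^sub>R (((o\<^sub>L) A) ^^ i) id_blinfun)"

text \<open>\<open>f(A)\<close> for a bounded self-adjoint operator \<open>A\<close> (whose spectrum is real) and a real
  function \<open>f\<close> that is continuous on the spectrum: the norm limit of \<open>p\<^sub>n(A)\<close> for polynomials
  \<open>p\<^sub>n\<close> converging to \<open>f\<close> uniformly on the spectrum.\<close>

definition fun_calc :: "(real \<Rightarrow> real) \<Rightarrow> ('a::complex_hilbert \<Rightarrow>\<^sub>L 'a) \<Rightarrow> 'a \<Rightarrow>\<^sub>L 'a" where
  "fun_calc f A =
     (THE T. \<forall>p :: nat \<Rightarrow> real poly.
        uniform_limit {r. complex_of_real r \<in> op_spectrum A} (\<lambda>n. poly (p n)) f sequentially \<longrightarrow>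
        (\<lambda>n. poly_op (p n) A) \<longlonglongrightarrow> T)"

definition exp_ereal :: "ereal \<Rightarrow> ereal" where
  "exp_ereal x =
     (if x = \<infinity> then \<infinity> else if x = -\<infinity> then 0 else ereal (exp (real_of_ereal x)))"

text \<open>The inner product below is real, as the logarithm of a positive invertible operator is
  self-adjoint; the limit is taken in the extended reals, since it may be \<open>-\<infinity>\<close>.\<close>

definition fs_det :: "'a::complex_hilbert \<Rightarrow> ('a \<Rightarrow>\<^sub>L 'a) \<Rightarrow> ereal" where
  "fs_det x A =
     exp_ereal (Lim (at_right 0)
       (\<lambda>\<epsilon>::real. ereal (Re (cinner (fun_calc ln (A + \<epsilon> *\<^sub>R id_blinfun) x) x))))"

definition FSD :: "('a::complex_hilbert \<Rightarrow> real) \<Rightarrow> 'a \<Rightarrow> ereal" where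
  "FSD u a = (INF x\<in>sphere 0 1. fs_det x (levi_op u a))"

end

theory Submission
  imports Defs "HOL-Computational_Algebra.Fundamental_Theorem_Algebra"
begin

text \<open>Jensen's inequality for the concave function \<open>ln\<close> gives
  \<open>\<langle>ln (A + \<epsilon>) x, x\<rangle> \<le> ln \<langle>(A + \<epsilon>) x, x\<rangle>\<close> for a unit vector \<open>x\<close>, so the determinant of \<open>A\<close> at
  \<open>x\<close> is at most \<open>\<langle>A x, x\<rangle>\<close> (\<open>fs_det_le\<close>). Hence the determinant density can only be positive at \<open>a\<close>
  if the Levi operator there is coercive, \<open>\<langle>A x, x\<rangle> \<ge> c \<parallel>x\<parallel>\<^sup>2\<close> with \<open>c > 0\<close>. Maximality rules this
  out (\<open>maximal_psh_levi_op_not_coercive\<close>): coercivity persists, with \<open>c / 2\<close>, on a small ball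
  around \<open>a\<close> because the second derivative is continuous, and then
  \<open>v z = u z + c / 4 * (r\<^sup>2 - \<parallel>z - a\<parallel>\<^sup>2)\<close> is still plurisubharmonic on the ball of radius \<open>r\<close>, agrees
  with \<open>u\<close> on the sphere, and exceeds \<open>u\<close> at the centre.

  Two ingredients take most of the work. First, \<open>v\<close> must be shown to satisfy the sub-mean value
  inequality on discs of every size, starting from second-order information at points. Averaging
  over rotations by \<open>n\<close>-th roots of unity preserves strict subharmonicity, so by the maximum
  principle the average at the centre is at most an average over \<open>n\<close> equidistant points of the unit
  circle, and these averages are Riemann sums of the circle integral
  (\<open>strict_four_point_submean_disc\<close>).

  Second, the logarithm of an operator is a norm limit of polynomials that converge only on the
  spectrum. All operators here are symmetric and all polynomials real, so one can argue entirely in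
  the underlying real Hilbert space. The key fact is that \<open>p(A) \<ge> c\<close> as a form whenever \<open>p \<ge> c\<close> on
  the spectrum (\<open>poly_op_lower_bound\<close>). It holds because the infimum \<open>m\<close> of the form of \<open>p(A)\<close> makes
  \<open>p(A) - m\<close> fail to be bounded below, while a product of linear factors \<open>A - r\<close> with \<open>r\<close> off the
  spectrum and of quadratic factors without real roots is bounded below; so \<open>p\<close> takes the value \<open>m\<close>
  on the spectrum. This gives convergence and monotonicity of the calculus, and therefore both the
  existence of the limit as \<open>\<epsilon>\<close> tends to \<open>0\<close> and Jensen's inequality.\<close>


section \<open>Complex scalars and the real Hilbert space structure\<close>

instance complex_hilbert \<subseteq> banach ..

lemma ii_scaleC_twice [simp]: "\<i> *\<^sub>C \<i> *\<^sub>C x = - (x::'a::complex_hilbert)"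
  using scaleR_eq_scaleC[of "-1" x] by (simp add: scaleC_scaleC)

lemma scaleC_scaleR_right: "c *\<^sub>C (r *\<^sub>R x) = r *\<^sub>R (c *\<^sub>C (x::'a::complex_hilbert))"
  by (simp add: scaleR_eq_scaleC scaleC_scaleC mult.commute)

lemma scaleC_scaleR_left: "(r *\<^sub>R (c::complex)) *\<^sub>C x = r *\<^sub>R (c *\<^sub>C (x::'a::complex_hilbert))"
  unfolding scaleR_conv_of_real by (simp only: scaleR_eq_scaleC scaleC_scaleC)

lemma cinner_scaleC_right: "cinner x (c *\<^sub>C y) = cnj c * cinner (x::'a::complex_hilbert) y"
  by (metis cinner_commute cinner_scaleC_left complex_cnj_mult)

lemma norm_scaleC [simp]: "norm (c *\<^sub>C x) = cmod c * norm (x::'a::complex_hilbert)"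
proof -
  have "complex_of_real ((norm (c *\<^sub>C x))\<^sup>2) = c * (cnj c * complex_of_real ((norm x)\<^sup>2))"
    by (simp only: cinner_self[symmetric] cinner_scaleC_left cinner_scaleC_right mult.left_commute)
  also have "\<dots> = complex_of_real ((cmod c * norm x)\<^sup>2)"
    by (simp add: power_mult_distrib complex_norm_square[symmetric])
  finally have "complex_of_real ((norm (c *\<^sub>C x))\<^sup>2) = complex_of_real ((cmod c * norm x)\<^sup>2)" .
  then have "(norm (c *\<^sub>C x))\<^sup>2 = (cmod c * norm x)\<^sup>2" by (rule of_real_eq_iff[THEN iffD1])
  then show ?thesis by (rule power2_eq_imp_eq) auto
qed

lemma bounded_linear_scaleC_right: "bounded_linear (\<lambda>x::'a::complex_hilbert. c *\<^sub>C x)"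
  by (rule bounded_linear_intro[where K = "cmod c"]) (simp_all add: scaleC_add_right scaleC_scaleR_right mult.commute)

lemma bounded_linear_scaleC_left: "bounded_linear (\<lambda>c. c *\<^sub>C (x::'a::complex_hilbert))"
  by (rule bounded_linear_intro[where K = "norm x"]) (simp_all add: scaleC_add_left scaleC_scaleR_left)

lemma cis_scaleC: "cis \<theta> *\<^sub>C x = cos \<theta> *\<^sub>R x + sin \<theta> *\<^sub>R (\<i> *\<^sub>C (x::'a::complex_hilbert))"
proof -
  have "cis \<theta> = of_real (cos \<theta>) + of_real (sin \<theta>) * \<i>" by (simp add: complex_eq_iff)
  then show ?thesis by (simp add: scaleC_add_left scaleR_eq_scaleC scaleC_scaleC)
qed


section \<open>Second-order calculus of C2 functions\<close>

lemma D1_has_derivative: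
  assumes "f differentiable at z"
  shows "(f has_derivative blinfun_apply (D1 f z)) (at z)"
proof -
  have "(f has_derivative frechet_derivative f (at z)) (at z)"
    using assms by (simp flip: frechet_derivative_works)
  then show ?thesis
    unfolding D1_def by (simp add: bounded_linear_Blinfun_apply has_derivative_bounded_linear)
qed

lemma D1_along_line:
  fixes f :: "'a::real_normed_vector \<Rightarrow> real"
  assumes "f differentiable at (a + t *\<^sub>R k)"
  shows "((\<lambda>t. f (a + t *\<^sub>R k)) has_real_derivative D1 f (a + t *\<^sub>R k) k) (at t)"
proof -
  have "((\<lambda>t. a + t *\<^sub>R k) has_derivative (\<lambda>s. s *\<^sub>R k)) (at t)"
    by (auto intro!: derivative_eq_intros)
  from diff_chain_at[OF this D1_has_derivative[OF assms]]
  show ?thesis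
    by (simp add: has_field_derivative_def o_def blinfun.scaleR_right mult.commute[of _ "D1 f (a + t *\<^sub>R k) k"])
qed

lemma C2_on_continuous: "C2_on \<Omega> f \<Longrightarrow> continuous_on \<Omega> f"
  by (auto simp: C2_on_def intro!: continuous_at_imp_continuous_on differentiable_imp_continuous_within)

text \<open>The radius \<open>d\<close> serves both second-order estimates below: the Taylor expansion and the symmetry of
  the second derivative use differentiability of the gradient at the single point \<open>a\<close>.\<close>

lemma D1_linearization:
  fixes f :: "'a::real_normed_vector \<Rightarrow> 'b::real_normed_vector"
  assumes "open \<Omega>" "C2_on \<Omega> f" "a \<in> \<Omega>" "e > 0"
  obtains d where "d > 0" "\<And>v. norm v < d \<Longrightarrow> a + v \<in> \<Omega>"
    "\<And>v. norm v < d \<Longrightarrow> norm (D1 f (a + v) - D1 f a - blinfun_apply (D2 f a) v) \<le> e * norm v"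
proof -
  have "(D1 f has_derivative blinfun_apply (D2 f a)) (at a)"
    unfolding D2_def using assms by (intro D1_has_derivative) (auto simp: C2_on_def)
  then obtain d1 where d1: "d1 > 0"
    "\<And>y. norm (y - a) < d1 \<Longrightarrow> norm (D1 f y - D1 f a - D2 f a (y - a)) \<le> e * norm (y - a)"
    using \<open>e > 0\<close> unfolding has_derivative_at_alt by blast
  obtain d2 where d2: "d2 > 0" "ball a d2 \<subseteq> \<Omega>"
    using assms by (meson open_contains_ball)
  show ?thesis
  proof (rule that[of "min d1 d2"])
    fix v :: 'a assume "norm v < min d1 d2"
    then show "a + v \<in> \<Omega>" "norm (D1 f (a + v) - D1 f a - blinfun_apply (D2 f a) v) \<le> e * norm v"
      using d1(2)[of "a + v"] d2(2) by (auto simp: subset_iff dist_norm)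
  qed (use d1 d2 in auto)
qed

text \<open>The mean value theorem on the segment from \<open>a\<close> to \<open>a + k\<close>, applied to the remainder, whose
  derivative is the linearization error of the gradient.\<close>

lemma taylor2:
  fixes f :: "'a::real_normed_vector \<Rightarrow> real"
  assumes \<Omega>: "open \<Omega>" and f: "C2_on \<Omega> f" and a: "a \<in> \<Omega>" and e: "e > 0"
  obtains d where "d > 0" "\<And>k. norm k < d \<Longrightarrow> a + k \<in> \<Omega>"
    "\<And>k. norm k < d \<Longrightarrow> \<bar>f (a + k) - f a - D1 f a k - D2 f a k k / 2\<bar> \<le> e * (norm k)\<^sup>2"
proof -
  obtain d where d: "d > 0" "\<And>v. norm v < d \<Longrightarrow> a + v \<in> \<Omega>"
    "\<And>v. norm v < d \<Longrightarrow> norm (D1 f (a + v) - D1 f a - D2 f a v) \<le> e * norm v"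
    by (rule D1_linearization[OF assms]) blast
  have "\<bar>f (a + k) - f a - D1 f a k - D2 f a k k / 2\<bar> \<le> e * (norm k)\<^sup>2" if k: "norm k < d" for k
  proof -
    \<comment> \<open>The remainder along the segment; \<open>g 1 - g 0\<close> is the quantity to be estimated.\<close>
    define g where "g t = f (a + t *\<^sub>R k) - t * D1 f a k - t\<^sup>2 * (D2 f a k k / 2)" for t
    define g' where "g' t = D1 f (a + t *\<^sub>R k) k - D1 f a k - D2 f a (t *\<^sub>R k) k" for t
    have small: "norm (t *\<^sub>R k) < d" "norm (t *\<^sub>R k) \<le> norm k" if "0 \<le> t" "t \<le> 1" for t
      using mult_right_mono[of t 1 "norm k"] that k by auto
    have "(g has_real_derivative g' t) (at t)" if "0 \<le> t" "t \<le> 1" for t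
    proof -
      have "f differentiable at (a + t *\<^sub>R k)" using f d(2) small(1)[OF that] by (auto simp: C2_on_def)
      then show ?thesis unfolding g_def g'_def
        by (auto intro!: derivative_eq_intros D1_along_line simp: blinfun.bilinear_simps)
    qed
    then obtain t where t: "0 < t" "t < 1" "g 1 - g 0 = (1 - 0) * g' t"
      using MVT2[of 0 1 g g'] by auto
    have "\<bar>g' t\<bar> = norm ((D1 f (a + t *\<^sub>R k) - D1 f a - D2 f a (t *\<^sub>R k)) k)"
      by (simp add: g'_def blinfun.bilinear_simps)
    also have "\<dots> \<le> norm (D1 f (a + t *\<^sub>R k) - D1 f a - D2 f a (t *\<^sub>R k)) * norm k" by (rule norm_blinfun)
    also have "\<dots> \<le> (e * norm (t *\<^sub>R k)) * norm k"
      using t small(1)[of t] by (intro mult_right_mono d(3)) auto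
    also have "\<dots> \<le> (e * norm k) * norm k"
      using t e small(2)[of t] by (intro mult_right_mono mult_left_mono) auto
    finally show ?thesis using t(3) by (simp add: g_def power2_eq_square mult.assoc)
  qed
  then show ?thesis using that d by blast
qed

text \<open>The second difference is an increment in direction \<open>x\<close> of the increment in direction \<open>y\<close>. One
  application of the mean value theorem leaves a difference of two gradients, whose linear part is
  \<open>D2 f a (h *\<^sub>R y) x\<close>.\<close>

lemma second_difference_quotient:
  fixes f :: "'a::real_normed_vector \<Rightarrow> real"
  assumes \<Omega>: "open \<Omega>" and f: "C2_on \<Omega> f" and a: "a \<in> \<Omega>" and e: "e > 0"
  shows "\<forall>\<^sub>F h in at_right 0.
    \<bar>(f (a + h *\<^sub>R x + h *\<^sub>R y) - f (a + h *\<^sub>R x) - f (a + h *\<^sub>R y) + f a) - h\<^sup>2 * D2 f a y x\<bar>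
      \<le> h\<^sup>2 * (2 * e * (norm x + norm y)\<^sup>2)"
proof -
  obtain d where d: "d > 0" "\<And>v. norm v < d \<Longrightarrow> a + v \<in> \<Omega>"
    "\<And>v. norm v < d \<Longrightarrow> norm (D1 f (a + v) - D1 f a - D2 f a v) \<le> e * norm v"
    by (rule D1_linearization[OF assms]) blast
  let ?S = "norm x + norm y"
  have S1: "?S + 1 > 0" by (simp add: add_nonneg_pos)
  have "\<forall>\<^sub>F h in at_right 0. h \<in> {0<..<d / (?S + 1)}"
    using d(1) S1 by (intro eventually_at_right_real) simp
  then show ?thesis
  proof eventually_elim
    case (elim h)
    then have h: "h > 0" and "h * (?S + 1) < d" using S1 by (auto simp: field_simps)
    then have hS: "h * ?S < d" by (simp add: algebra_simps)
    have nrm: "norm (t *\<^sub>R x + h *\<^sub>R y) \<le> h * ?S" "norm (t *\<^sub>R x) \<le> h * ?S" if "0 \<le> t" "t \<le> h" for t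
    proof -
      have 1: "t * norm x \<le> h * norm x" using that by (intro mult_right_mono) auto
      show "norm (t *\<^sub>R x + h *\<^sub>R y) \<le> h * ?S"
        using norm_triangle_ineq[of "t *\<^sub>R x" "h *\<^sub>R y"] 1 that by (simp add: distrib_left)
      show "norm (t *\<^sub>R x) \<le> h * ?S"
        using 1 that by (simp add: distrib_left add_increasing2)
    qed
    define g where "g t = f ((a + h *\<^sub>R y) + t *\<^sub>R x) - f (a + t *\<^sub>R x)" for t
    define g' where "g' t = D1 f ((a + h *\<^sub>R y) + t *\<^sub>R x) x - D1 f (a + t *\<^sub>R x) x" for t
    have diff: "f differentiable at (a + v)" if "norm v < d" for v
      using f d(2)[OF that] by (auto simp: C2_on_def)
    have "(g has_real_derivative g' t) (at t)" if t: "0 \<le> t" "t \<le> h" for t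
    proof -
      have "f differentiable at ((a + h *\<^sub>R y) + t *\<^sub>R x)" "f differentiable at (a + t *\<^sub>R x)"
        using diff[of "t *\<^sub>R x + h *\<^sub>R y"] diff[of "t *\<^sub>R x"] nrm[OF t] hS by (simp_all add: ac_simps)
      then show ?thesis unfolding g_def g'_def by (intro DERIV_diff D1_along_line)
    qed
    then obtain t where t: "0 < t" "t < h" "g h - g 0 = (h - 0) * g' t"
      using MVT2[of 0 h g g'] h by auto
    define R where "R v = D1 f (a + v) - D1 f a - D2 f a v" for v
    have R: "\<bar>R v x\<bar> \<le> e * (h * ?S) * ?S" if "norm v \<le> h * ?S" for v
    proof -
      have "\<bar>R v x\<bar> \<le> norm (R v) * norm x" using norm_blinfun[of "R v" x] by simp
      also have "\<dots> \<le> (e * norm v) * norm x"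
        unfolding R_def using that hS by (intro mult_right_mono d(3)) auto
      also have "\<dots> \<le> (e * (h * ?S)) * ?S" using that e h by (intro mult_mono) auto
      finally show ?thesis .
    qed
    have "g' t = h * D2 f a y x + (R (t *\<^sub>R x + h *\<^sub>R y) x - R (t *\<^sub>R x) x)"
      by (simp add: g'_def R_def blinfun.bilinear_simps ac_simps)
    then have "\<bar>g' t - h * D2 f a y x\<bar> \<le> 2 * (e * (h * ?S) * ?S)"
      using R[OF nrm(1)[of t]] R[OF nrm(2)[of t]] t by linarith
    then have "h * \<bar>g' t - h * D2 f a y x\<bar> \<le> h * (2 * (e * (h * ?S) * ?S))"
      using h by (intro mult_left_mono) auto
    moreover have "h * \<bar>g' t - h * D2 f a y x\<bar> = \<bar>h * g' t - h\<^sup>2 * D2 f a y x\<bar>"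
      using h by (simp add: abs_mult[symmetric, of h, unfolded abs_of_pos[OF h]] abs_mult_pos' right_diff_distrib power2_eq_square)
    ultimately show ?case using t(3) by (simp add: g_def power2_eq_square ac_simps algebra_simps)
  qed
qed

text \<open>The second difference is symmetric in \<open>x\<close> and \<open>y\<close>, so both mixed values are limits of the same
  quotient.\<close>

lemma D2_symmetric:
  fixes f :: "'a::real_normed_vector \<Rightarrow> real"
  assumes \<Omega>: "open \<Omega>" and f: "C2_on \<Omega> f" and a: "a \<in> \<Omega>"
  shows "D2 f a x y = D2 f a y x"
proof (rule ccontr)
  assume ne: "D2 f a x y \<noteq> D2 f a y x"
  let ?S = "(norm x + norm y)\<^sup>2"
  let ?D = "\<bar>D2 f a x y - D2 f a y x\<bar>"
  define e where "e = ?D / (8 * (?S + 1))"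
  have S1: "?S + 1 > 0" by (simp add: add_nonneg_pos)
  then have e: "e > 0" using ne by (simp add: e_def)
  have eD: "e * (8 * (?S + 1)) = ?D" unfolding e_def using S1 by (intro nonzero_eq_divide_eq[THEN iffD1] refl) simp
  have "\<forall>\<^sub>F h in at_right (0::real). False"
    using second_difference_quotient[OF assms e, of x y] second_difference_quotient[OF assms e, of y x]
      eventually_at_right_less[of 0]
  proof eventually_elim
    case (elim h)
    let ?\<Delta> = "f (a + h *\<^sub>R x + h *\<^sub>R y) - f (a + h *\<^sub>R x) - f (a + h *\<^sub>R y) + f a"
    have "\<bar>?\<Delta> - h\<^sup>2 * D2 f a y x\<bar> \<le> h\<^sup>2 * (2 * e * ?S)" "\<bar>?\<Delta> - h\<^sup>2 * D2 f a x y\<bar> \<le> h\<^sup>2 * (2 * e * ?S)"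
      using elim by (simp_all add: ac_simps)
    then have "\<bar>h\<^sup>2 * D2 f a x y - h\<^sup>2 * D2 f a y x\<bar> \<le> h\<^sup>2 * (4 * e * ?S)" by linarith
    moreover have "\<bar>h\<^sup>2 * D2 f a x y - h\<^sup>2 * D2 f a y x\<bar> = h\<^sup>2 * ?D"
      by (simp add: abs_mult flip: right_diff_distrib)
    ultimately have "?D \<le> 4 * e * ?S" using elim by simp
    also have "\<dots> < 8 * e * (?S + 1)"
    proof -
      have "0 \<le> e * ?S" using e by simp
      then show ?thesis using e by (simp only: distrib_left mult.assoc)
    qed
    also have "\<dots> = ?D" using eD by (simp add: algebra_simps)
    finally show ?case by simp
  qed
  then show False by simp
qed


section \<open>The Levi operator\<close>

text \<open>The representing vector minimises \<open>\<parallel>x\<parallel>\<^sup>2 - 2 \<phi>(x)\<close>. By the parallelogram law minimising sequences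
  are Cauchy, and completeness gives the minimiser.\<close>

lemma riesz_representation:
  fixes \<phi> :: "'a::{real_inner,complete_space} \<Rightarrow> real"
  assumes \<phi>: "bounded_linear \<phi>"
  obtains x where "\<And>t. \<phi> t = inner x t"
proof -
  interpret \<phi>: bounded_linear \<phi> by fact
  define J where "J x = (norm x)\<^sup>2 - 2 * \<phi> x" for x
  obtain K where K: "\<And>x. \<bar>\<phi> x\<bar> \<le> norm x * K" using \<phi>.bounded by auto
  have bdd: "bdd_below (range J)"
  proof (rule bdd_belowI2)
    fix x :: 'a
    have "0 \<le> (norm x - K)\<^sup>2" by simp
    also have "\<dots> = (norm x)\<^sup>2 - 2 * (norm x * K) + K\<^sup>2" by (simp add: power2_diff)
    finally show "- K\<^sup>2 \<le> J x" using K[of x] by (simp add: J_def)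
  qed
  define m where "m = Inf (range J)"
  have m: "m \<le> J x" for x unfolding m_def by (rule cInf_lower[OF _ bdd]) simp
  have "\<exists>x. J x < m + inverse (real (Suc n))" for n
    using cInf_lessD[of "range J" "m + inverse (real (Suc n))"] by (auto simp: m_def)
  then obtain x where x: "\<And>n. J (x n) < m + inverse (real (Suc n))" by metis
  have par: "(norm (y - z))\<^sup>2 = 2 * J y + 2 * J z - 4 * J ((1/2) *\<^sub>R (y + z))" for y z
    by (simp add: J_def power2_norm_eq_inner inner_diff_left inner_diff_right inner_add_left inner_add_right
        inner_commute \<phi>.scaleR \<phi>.add algebra_simps)
  have "Cauchy x"
  proof (rule CauchyI)
    fix e :: real assume e: "e > 0"
    obtain N where N: "inverse (real (Suc N)) < e\<^sup>2 / 4"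
      using reals_Archimedean[of "e\<^sup>2 / 4"] e by auto
    have "norm (x i - x j) < e" if "i \<ge> N" "j \<ge> N" for i j
    proof -
      have "inverse (real (Suc i)) \<le> inverse (real (Suc N))" "inverse (real (Suc j)) \<le> inverse (real (Suc N))"
        using that by simp_all
      then have "J (x i) < m + e\<^sup>2 / 4" "J (x j) < m + e\<^sup>2 / 4" using x[of i] x[of j] N by linarith+
      then have "(norm (x i - x j))\<^sup>2 < e\<^sup>2" using m[of "(1/2) *\<^sub>R (x i + x j)"] unfolding par by linarith
      then show ?thesis by (rule power_less_imp_less_base) (use e in simp)
    qed
    then show "\<exists>M. \<forall>i\<ge>M. \<forall>j\<ge>M. norm (x i - x j) < e" by blast
  qed
  then obtain y where y: "x \<longlonglongrightarrow> y" by (auto simp: Cauchy_convergent_iff convergent_def)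
  have "J y \<le> m"
  proof (rule tendsto_le)
    show "(\<lambda>n. J (x n)) \<longlonglongrightarrow> J y" unfolding J_def by (intro tendsto_intros \<phi>.tendsto y)
    show "(\<lambda>n. m + inverse (real (Suc n))) \<longlonglongrightarrow> m"
      using LIMSEQ_inverse_real_of_nat_add[of m] by simp
    show "\<forall>\<^sub>F n in sequentially. J (x n) \<le> m + inverse (real (Suc n))" using x by (simp add: less_imp_le)
  qed simp
  have "\<phi> t = inner y t" for t
  proof (rule ccontr)
    assume ne: "\<phi> t \<noteq> inner y t"
    define \<delta> where "\<delta> = inner y t - \<phi> t"
    have t: "(norm t)\<^sup>2 > 0" using ne by (auto simp: \<phi>.zero)
    \<comment> \<open>The step that minimises \<open>J\<close> along the line through \<open>y\<close> in direction \<open>t\<close>.\<close>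
    define s where "s = - \<delta> / (norm t)\<^sup>2"
    have "J (y + s *\<^sub>R t) = J y + 2 * s * \<delta> + s\<^sup>2 * (norm t)\<^sup>2"
      by (simp add: J_def \<delta>_def power2_norm_eq_inner inner_add_left inner_add_right inner_commute
          \<phi>.scaleR \<phi>.add power2_eq_square[of s] algebra_simps)
    also have "\<dots> = J y - \<delta>\<^sup>2 / (norm t)\<^sup>2" using t by (simp add: s_def power2_eq_square field_simps)
    also have "\<dots> < J y" using t ne by (simp add: \<delta>_def)
    finally show False using m[of "y + s *\<^sub>R t"] \<open>J y \<le> m\<close> by linarith
  qed
  then show ?thesis using that by blast
qed

lemma inner_eq_ext: "(\<And>t. inner x t = inner y t) \<Longrightarrow> x = y"
  using vector_eq_rdot[of x y] by blast

text \<open>The Riesz theorem represents the real part of the Levi form. The imaginary part comes for free,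
  since both sides are conjugate linear in \<open>t\<close>: the imaginary part at \<open>t\<close> is the real part at \<open>\<i> t\<close>.\<close>

lemma levi_op_inner:
  fixes u :: "'a::complex_hilbert \<Rightarrow> real"
  shows "inner (levi_op u a s) t = (D2 u a s t + D2 u a (\<i> *\<^sub>C s) (\<i> *\<^sub>C t)) / 4"
proof -
  let ?D = "D2 u a"
  define b where "b s t = (?D s t + ?D (\<i> *\<^sub>C s) (\<i> *\<^sub>C t)) / 4" for s t
  interpret I: bounded_linear "\<lambda>x::'a. \<i> *\<^sub>C x" by (rule bounded_linear_scaleC_right)
  have b_lin: "bounded_linear (b s)" for s
  proof (rule bounded_linear_intro[where K = "norm (?D s) + norm (?D (\<i> *\<^sub>C s))"])
    fix t
    have "\<bar>b s t\<bar> \<le> \<bar>?D s t\<bar> + \<bar>?D (\<i> *\<^sub>C s) (\<i> *\<^sub>C t)\<bar>" by (simp add: b_def)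
    also have "\<dots> \<le> norm (?D s) * norm t + norm (?D (\<i> *\<^sub>C s)) * norm t"
      using norm_blinfun[of "?D s" t] norm_blinfun[of "?D (\<i> *\<^sub>C s)" "\<i> *\<^sub>C t"] by simp
    finally show "norm (b s t) \<le> norm t * (norm (?D s) + norm (?D (\<i> *\<^sub>C s)))" by (simp add: algebra_simps)
  qed (simp_all add: b_def I.add I.scaleR blinfun.bilinear_simps field_simps)
  obtain r where r: "\<And>s t. b s t = inner (r s) t"
  proof -
    have "\<exists>x. \<forall>t. b s t = inner x t" for s
      by (rule riesz_representation[OF b_lin[of s]]) blast
    then show ?thesis using that by metis
  qed
  have "bounded_linear r"
  proof (rule bounded_linear_intro[where K = "norm ?D"])
    show "r (s + s') = r s + r s'" for s s'
      by (rule inner_eq_ext) (simp add: inner_add_left r[symmetric] b_def I.add blinfun.bilinear_simps add_divide_distrib)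
    show "r (c *\<^sub>R s) = c *\<^sub>R r s" for c s
      by (rule inner_eq_ext) (simp add: r[symmetric] b_def I.scaleR blinfun.bilinear_simps algebra_simps)
    show "norm (r s) \<le> norm s * norm ?D" for s
    proof -
      have bd: "\<bar>?D v w\<bar> \<le> norm ?D * norm v * norm w" for v w
        using norm_blinfun[of "?D v" w] mult_right_mono[OF norm_blinfun[of ?D v], of "norm w"] by simp
      have "norm (r s) * norm (r s) = b s (r s)" by (simp add: r norm_eq_sqrt_inner)
      also have "\<dots> \<le> norm ?D * norm s * norm (r s)"
        using bd[of s "r s"] bd[of "\<i> *\<^sub>C s" "\<i> *\<^sub>C r s"] by (simp add: b_def)
      finally show ?thesis by (cases "r s = 0") (auto simp: mult.commute)
    qed
  qed
  then have R: "Blinfun r s = r s" for s by (simp add: bounded_linear_Blinfun_apply)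
  have "levi_op u a = Blinfun r"
    unfolding levi_op_def
  proof (rule the_equality)
    have "cinner (r s) t = levi_form u a s t" for s t
    proof (rule complex_eqI)
      show "Re (cinner (r s) t) = Re (levi_form u a s t)"
        by (simp add: inner_eq_Re_cinner[symmetric] r[symmetric] b_def levi_form_def)
      have "Im (cinner (r s) t) = inner (r s) (\<i> *\<^sub>C t)"
        by (simp add: inner_eq_Re_cinner cinner_scaleC_right)
      also have "\<dots> = Im (levi_form u a s t)"
        by (simp add: r[symmetric] b_def levi_form_def blinfun.bilinear_simps)
      finally show "Im (cinner (r s) t) = Im (levi_form u a s t)" .
    qed
    then show "\<forall>s t. cinner (Blinfun r s) t = levi_form u a s t" using R by simp
    fix A assume A: "\<forall>s t. cinner (blinfun_apply A s) t = levi_form u a s t"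
    show "A = Blinfun r"
    proof (rule blinfun_eqI, rule inner_eq_ext)
      fix s t
      show "inner (A s) t = inner (Blinfun r s) t"
        using A \<open>\<And>s t. cinner (r s) t = levi_form u a s t\<close> R by (simp add: inner_eq_Re_cinner)
    qed
  qed
  then show ?thesis using R r by (simp add: b_def)
qed

lemma symmetric_levi_op:
  fixes u :: "'a::complex_hilbert \<Rightarrow> real"
  assumes "open \<Omega>" "C2_on \<Omega> u" "a \<in> \<Omega>"
  shows "inner (levi_op u a s) t = inner s (levi_op u a t)"
  using D2_symmetric[OF assms] by (simp add: levi_op_inner inner_commute[of s])

text \<open>The Levi form changes by at most half of the change of the second derivative in norm.\<close>

lemma levi_op_lower_bound_nearby:
  fixes u :: "'a::complex_hilbert \<Rightarrow> real"
  assumes \<Omega>: "open \<Omega>" and u: "C2_on \<Omega> u" and a: "a \<in> \<Omega>" and c: "c > 0"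
    and levi: "\<And>x. c * (norm x)\<^sup>2 \<le> inner (levi_op u a x) x"
  obtains r where "r > 0" "cball a r \<subseteq> \<Omega>"
    "\<And>p x. p \<in> cball a r \<Longrightarrow> c / 2 * (norm x)\<^sup>2 \<le> inner (levi_op u p x) x"
proof -
  have "isCont (D2 u) a"
    using u \<Omega> a by (auto simp: C2_on_def continuous_on_eq_continuous_at)
  then obtain d1 where d1: "d1 > 0" "\<And>p. dist p a < d1 \<Longrightarrow> dist (D2 u p) (D2 u a) < c"
    using c unfolding continuous_at_eps_delta by blast
  obtain d2 where d2: "d2 > 0" "cball a d2 \<subseteq> \<Omega>" using \<Omega> a by (meson open_contains_cball)
  define r where "r = min (d1 / 2) d2"
  show ?thesis
  proof (rule that[of r])
    show "r > 0" "cball a r \<subseteq> \<Omega>" using d1 d2 by (auto simp: r_def)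
    fix p x assume "p \<in> cball a r"
    then have "dist p a < d1" using d1(1) by (simp add: r_def dist_commute)
    then have "norm (D2 u p - D2 u a) < c" using d1(2) by (simp only: dist_norm)
    then have close: "\<bar>D2 u p w w - D2 u a w w\<bar> \<le> c * (norm w)\<^sup>2" for w
    proof -
      have "\<bar>D2 u p w w - D2 u a w w\<bar> = norm ((D2 u p - D2 u a) w w)" by (simp add: blinfun.bilinear_simps)
      also have "\<dots> \<le> norm ((D2 u p - D2 u a) w) * norm w" by (rule norm_blinfun)
      also have "\<dots> \<le> (norm (D2 u p - D2 u a) * norm w) * norm w" by (intro mult_right_mono norm_blinfun) simp
      also have "\<dots> \<le> (c * norm w) * norm w"
        using \<open>norm (D2 u p - D2 u a) < c\<close> by (intro mult_right_mono) auto
      finally show ?thesis by (simp add: power2_eq_square)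
    qed
    show "c / 2 * (norm x)\<^sup>2 \<le> inner (levi_op u p x) x"
    proof -
      have "\<bar>D2 u p x x - D2 u a x x\<bar> \<le> c * (norm x)\<^sup>2"
        "\<bar>D2 u p (\<i> *\<^sub>C x) (\<i> *\<^sub>C x) - D2 u a (\<i> *\<^sub>C x) (\<i> *\<^sub>C x)\<bar> \<le> c * (norm x)\<^sup>2"
        using close[of x] close[of "\<i> *\<^sub>C x"] by simp_all
      moreover have "c * (norm x)\<^sup>2 \<le> (D2 u a x x + D2 u a (\<i> *\<^sub>C x) (\<i> *\<^sub>C x)) / 4"
        using levi[of x] by (simp only: levi_op_inner)
      moreover have "N / 2 \<le> (A' + B') / 4"
        if "\<bar>A' - A\<bar> \<le> N" "\<bar>B' - B\<bar> \<le> N" "N \<le> (A + B) / 4" for A A' B B' N :: real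
        using that by (auto simp: abs_le_iff field_simps)
      ultimately have "(c * (norm x)\<^sup>2) / 2 \<le> (D2 u p x x + D2 u p (\<i> *\<^sub>C x) (\<i> *\<^sub>C x)) / 4"
        by blast
      then show ?thesis by (simp add: levi_op_inner)
    qed
  qed
qed


section \<open>Circle integrals and positivity of the Levi operator\<close>

lemma ereal_integral_continuous:
  fixes f :: "real \<Rightarrow> real"
  assumes f: "continuous_on {a..b} f"
  shows "ereal_integral (restrict_space lborel {a..b}) (\<lambda>\<theta>. ereal (f \<theta>)) = ereal (integral {a..b} f)"
proof -
  let ?M = "restrict_space lborel {a..b}"
  have set_int: "set_integrable lborel {a..b} f" by (rule borel_integrable_atLeastAtMost'[OF f])
  then have int: "integrable ?M f"
    by (simp add: integrable_restrict_space set_integrable_def)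
  then obtain p n where pn: "0 \<le> p" "0 \<le> n"
      "(\<integral>\<^sup>+ x. ennreal (f x) \<partial>?M) = ennreal p" "(\<integral>\<^sup>+ x. ennreal (- f x) \<partial>?M) = ennreal n"
      "integral\<^sup>L ?M f = p - n"
    by (rule integrableE)
  have "integral\<^sup>L ?M f = integral {a..b} f"
    using set_borel_integral_eq_integral(2)[OF set_int]
    by (simp add: integral_restrict_space set_lebesgue_integral_def)
  then show ?thesis using pn by (simp add: ereal_integral_def e2ennreal_ereal)
qed

lemma continuous_on_circle:
  fixes v :: "'a::complex_hilbert \<Rightarrow> real"
  assumes "continuous_on G v" "\<And>\<zeta>. cmod \<zeta> \<le> 1 \<Longrightarrow> z + \<zeta> *\<^sub>C h \<in> G"
  shows "continuous_on (cball 0 1) (\<lambda>\<zeta>. v (z + \<zeta> *\<^sub>C h))"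
    and "continuous_on S (\<lambda>\<theta>. v (z + cis \<theta> *\<^sub>C h))"
proof -
  show 1: "continuous_on (cball 0 1) (\<lambda>\<zeta>. v (z + \<zeta> *\<^sub>C h))"
    by (rule continuous_on_compose2[OF assms(1)])
      (auto intro!: continuous_intros bounded_linear.continuous_on[OF bounded_linear_scaleC_left] assms(2))
  show "continuous_on S (\<lambda>\<theta>. v (z + cis \<theta> *\<^sub>C h))"
    by (rule continuous_on_compose2[OF 1]) (auto intro!: continuous_intros)
qed

text \<open>The circle integral of a second-order Taylor polynomial, restricted to the complex line through
  \<open>k\<close>: the linear and mixed terms average out, and the two pure second-order terms each contribute
  half of their coefficient.\<close>

lemma circle_second_order_integral:
  "((\<lambda>\<theta>. A + cos \<theta> * B + sin \<theta> * C + (cos \<theta>)\<^sup>2 * P + (sin \<theta>)\<^sup>2 * Q + cos \<theta> * sin \<theta> * R)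
     has_integral pi * (2 * A + P + Q)) {0..2 * pi}"
proof -
  define F where "F \<theta> = \<theta> * A + sin \<theta> * B - cos \<theta> * C + (\<theta> / 2 + sin \<theta> * cos \<theta> / 2) * P
    + (\<theta> / 2 - sin \<theta> * cos \<theta> / 2) * Q + (sin \<theta>)\<^sup>2 / 2 * R" for \<theta>
  have "(F has_real_derivative A + cos \<theta> * B + sin \<theta> * C + (cos \<theta>)\<^sup>2 * P + (sin \<theta>)\<^sup>2 * Q + cos \<theta> * sin \<theta> * R)
      (at \<theta> within {0..2 * pi})" for \<theta>
  proof -
    \<comment> \<open>The double-angle formulas in the shape in which the derivative of \<open>F\<close> produces them.\<close>
    have "(cos \<theta>)\<^sup>2 = 1 / 2 + (cos \<theta> * cos \<theta> - sin \<theta> * sin \<theta>) / 2" "(sin \<theta>)\<^sup>2 = 1 / 2 - (cos \<theta> * cos \<theta> - sin \<theta> * sin \<theta>) / 2"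
      using sin_cos_squared_add[of \<theta>] by (simp_all add: power2_eq_square field_simps)
    then show ?thesis unfolding F_def
      by (auto intro!: derivative_eq_intros simp: diff_divide_distrib mult_ac)
  qed
  then have "((\<lambda>\<theta>. A + cos \<theta> * B + sin \<theta> * C + (cos \<theta>)\<^sup>2 * P + (sin \<theta>)\<^sup>2 * Q + cos \<theta> * sin \<theta> * R)
     has_integral F (2 * pi) - F 0) {0..2 * pi}"
    by (intro fundamental_theorem_of_calculus) (auto simp: has_real_derivative_iff_has_vector_derivative)
  then show ?thesis by (simp add: F_def algebra_simps)
qed

text \<open>Insert the Taylor expansion into the sub-mean value inequality on a small disc: the circle average
  of the second-order term is the Levi form, so the Levi form is nonnegative up to the Taylor error.\<close>

lemma psh_C2_levi_op_nonneg:
  fixes u :: "'a::complex_hilbert \<Rightarrow> real"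
  assumes \<Omega>: "open \<Omega>" and psh: "psh \<Omega> (\<lambda>z. ereal (u z))" and u: "C2_on \<Omega> u" and a: "a \<in> \<Omega>"
  shows "0 \<le> inner (levi_op u a h) h"
proof -
  have "0 \<le> inner (levi_op u a h) h + e * (norm h)\<^sup>2" if e: "e > 0" for e
  proof -
    obtain d where d: "d > 0" "\<And>k. norm k < d \<Longrightarrow> a + k \<in> \<Omega>"
      "\<And>k. norm k < d \<Longrightarrow> \<bar>u (a + k) - u a - D1 u a k - D2 u a k k / 2\<bar> \<le> e * (norm k)\<^sup>2"
      by (rule taylor2[OF \<Omega> u a e]) blast
    define r where "r = d / (norm h + 1)"
    have h1: "norm h + 1 > 0" by (simp add: add_nonneg_pos)
    then have r: "r > 0" "r * (norm h + 1) = d" using d(1) by (simp_all add: r_def)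
    then have rh: "r * norm h < d" by (simp add: distrib_left)
    define k where "k = r *\<^sub>R h"
    have k: "norm k < d" using r(1) rh by (simp add: k_def)
    have disc: "a + \<zeta> *\<^sub>C k \<in> \<Omega>" if "cmod \<zeta> \<le> 1" for \<zeta>
      using mult_right_mono[OF that, of "norm k"] k by (intro d(2)) simp
    have cont: "continuous_on {0..2 * pi} (\<lambda>\<theta>. u (a + cis \<theta> *\<^sub>C k))"
      by (rule continuous_on_circle(2)[OF C2_on_continuous[OF u] disc])
    define I where "I = integral {0..2 * pi} (\<lambda>\<theta>. u (a + cis \<theta> *\<^sub>C k))"
    have "ereal (u a) \<le> ereal (1 / (2 * pi)) * ereal I"
      using psh a disc unfolding psh_def I_def by (auto simp flip: ereal_integral_continuous[OF cont])
    then have mean: "2 * pi * u a \<le> I" by (simp add: field_simps)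
    define A where "A = u a + e * (norm k)\<^sup>2"
    define P where "P = D2 u a k k / 2"
    define Q where "Q = D2 u a (\<i> *\<^sub>C k) (\<i> *\<^sub>C k) / 2"
    define R where "R = (D2 u a k (\<i> *\<^sub>C k) + D2 u a (\<i> *\<^sub>C k) k) / 2"
    have "I \<le> pi * (2 * A + P + Q)"
      unfolding I_def
    proof (rule has_integral_le[OF integrable_integral circle_second_order_integral])
      show "(\<lambda>\<theta>. u (a + cis \<theta> *\<^sub>C k)) integrable_on {0..2 * pi}"
        by (rule integrable_continuous_real[OF cont])
      fix \<theta> :: real
      have "u (a + cis \<theta> *\<^sub>C k) \<le> u a + D1 u a (cis \<theta> *\<^sub>C k) + D2 u a (cis \<theta> *\<^sub>C k) (cis \<theta> *\<^sub>C k) / 2 + e * (norm k)\<^sup>2"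
        using d(3)[of "cis \<theta> *\<^sub>C k"] k by simp
      also have "\<dots> = A + cos \<theta> * D1 u a k + sin \<theta> * D1 u a (\<i> *\<^sub>C k) + (cos \<theta>)\<^sup>2 * P + (sin \<theta>)\<^sup>2 * Q + cos \<theta> * sin \<theta> * R"
        by (simp add: cis_scaleC A_def P_def Q_def R_def blinfun.bilinear_simps power2_eq_square
            add_divide_distrib distrib_left mult_ac)
      finally show "u (a + cis \<theta> *\<^sub>C k) \<le> \<dots>" .
    qed
    then have "pi * (2 * u a) \<le> pi * (2 * A + P + Q)" using mean by linarith
    then have "2 * u a \<le> 2 * A + P + Q" by simp
    then have "0 \<le> inner (levi_op u a k) k + e * (norm k)\<^sup>2"
      by (simp add: levi_op_inner A_def P_def Q_def field_simps)
    also have "\<dots> = r\<^sup>2 * (inner (levi_op u a h) h + e * (norm h)\<^sup>2)"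
      by (simp add: k_def blinfun.bilinear_simps power_mult_distrib power2_eq_square[of r] algebra_simps)
    finally show ?thesis using r(1) by (simp add: zero_le_mult_iff)
  qed
  note approx = this
  have "((\<lambda>e. inner (levi_op u a h) h + e * (norm h)\<^sup>2) \<longlongrightarrow> inner (levi_op u a h) h + 0 * (norm h)\<^sup>2) (at_right 0)"
    by (intro tendsto_intros)
  moreover have "\<forall>\<^sub>F e in at_right (0::real). 0 \<le> inner (levi_op u a h) h + e * (norm h)\<^sup>2"
    using eventually_at_right_less[of 0] by eventually_elim (rule approx)
  ultimately have "0 \<le> inner (levi_op u a h) h + 0 * (norm h)\<^sup>2"
    by (rule tendsto_lowerbound) simp
  then show ?thesis by simp
qed


section \<open>The sub-mean value inequality from a strict four-point inequality\<close>

text \<open>Induction over the subintervals, with an arbitrary lower bound \<open>c k\<close> on each, which may come from a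
  sampled value corrected by the modulus of continuity.\<close>

lemma lower_sum_le_integral:
  fixes \<psi> :: "real \<Rightarrow> real"
  assumes h: "h \<ge> 0" and cont: "continuous_on {0..real N * h} \<psi>"
    and le: "\<And>k \<theta>. k < N \<Longrightarrow> \<theta> \<in> {real k * h..real (Suc k) * h} \<Longrightarrow> c k \<le> \<psi> \<theta>"
  shows "m \<le> N \<Longrightarrow> (\<Sum>k<m. c k) * h \<le> integral {0..real m * h} \<psi>"
proof (induction m)
  case (Suc m)
  have mono: "real m * h \<le> real (Suc m) * h" "real (Suc m) * h \<le> real N * h"
    using h Suc.prems by (auto intro!: mult_right_mono)
  have int: "\<psi> integrable_on {0..real (Suc m) * h}"
    using mono by (intro integrable_continuous_real continuous_on_subset[OF cont]) auto
  have m0: "0 \<le> real m * h" using h by simp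
  have int': "\<psi> integrable_on {real m * h..real (Suc m) * h}"
    by (rule integrable_on_subinterval[OF int]) (use m0 in auto)
  have "c m * h = integral {real m * h..real (Suc m) * h} (\<lambda>_. c m)"
    using h by (simp add: algebra_simps)
  also have "\<dots> \<le> integral {real m * h..real (Suc m) * h} \<psi>"
    using le[of m] Suc.prems by (intro integral_le int') auto
  finally have "c m * h \<le> integral {real m * h..real (Suc m) * h} \<psi>" .
  moreover have "integral {0..real m * h} \<psi> + integral {real m * h..real (Suc m) * h} \<psi>
      = integral {0..real (Suc m) * h} \<psi>"
    by (rule Henstock_Kurzweil_Integration.integral_combine[OF m0 mono(1) int])
  ultimately show ?case using Suc by (simp add: algebra_simps)
qed simp

text \<open>At an interior maximum none of the four neighbouring values exceeds the central one, so their sum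
  cannot be strictly larger than four times the maximum. No differentiability is involved; the
  four-point inequality stands in for a positive Laplacian.\<close>

lemma strict_max_principle_disc:
  fixes w :: "complex \<Rightarrow> real"
  assumes cont: "continuous_on (cball 0 1) w"
    and four: "\<And>\<zeta>. \<zeta> \<in> ball 0 1 \<Longrightarrow> \<forall>\<^sub>F t in at_right 0.
        4 * w \<zeta> < w (\<zeta> + of_real t) + w (\<zeta> - of_real t) + w (\<zeta> + of_real t * \<i>) + w (\<zeta> - of_real t * \<i>)"
  obtains \<xi> where "cmod \<xi> = 1" "w 0 \<le> w \<xi>"
proof -
  obtain \<xi> where \<xi>: "\<xi> \<in> cball 0 1" and max: "\<And>z. z \<in> cball 0 1 \<Longrightarrow> w z \<le> w \<xi>"
    using continuous_attains_sup[OF compact_cball _ cont] by (metis cball_eq_empty not_one_less_zero)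
  have "\<not> cmod \<xi> < 1"
  proof
    assume lt: "cmod \<xi> < 1"
    have "\<forall>\<^sub>F t in at_right 0. t \<in> {0<..<1 - cmod \<xi>}"
      using lt by (intro eventually_at_right_real) simp
    then have "\<forall>\<^sub>F t in at_right (0::real). False"
      using four[of \<xi>, simplified, OF lt]
    proof eventually_elim
      case (elim t)
      have "w (\<xi> + v) \<le> w \<xi>" if "cmod v = t" for v
        using norm_triangle_ineq[of \<xi> v] elim that by (intro max) simp
      from this[of "of_real t"] this[of "- of_real t"] this[of "of_real t * \<i>"] this[of "- (of_real t * \<i>)"]
      show ?case using elim by (simp add: norm_mult)
    qed
    then show False by simp
  qed
  then show ?thesis using that \<xi> max[of 0] by simp
qed

text \<open>The average \<open>W\<close> over rotations by \<open>n\<close>-th roots of unity inherits the four-point inequality, so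
  \<open>W 0\<close>, which is \<open>n * \<phi> 0\<close>, is at most \<open>W \<xi>\<close> for some \<open>\<xi>\<close> on the unit circle. The value \<open>W \<xi>\<close> is a
  Riemann sum for the circle integral; by uniform continuity it is close to the integral uniformly
  in \<open>\<xi>\<close>, so it does not matter where the maximum principle places \<open>\<xi>\<close>.\<close>

lemma strict_four_point_submean_disc:
  fixes \<phi> :: "complex \<Rightarrow> real"
  assumes cont: "continuous_on (cball 0 1) \<phi>"
    and four: "\<And>\<zeta> \<kappa>. \<zeta> \<in> ball 0 1 \<Longrightarrow> cmod \<kappa> = 1 \<Longrightarrow> \<forall>\<^sub>F t in at_right 0.
        4 * \<phi> \<zeta> < \<phi> (\<zeta> + of_real t * \<kappa>) + \<phi> (\<zeta> - of_real t * \<kappa>)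
          + \<phi> (\<zeta> + of_real t * (\<i> * \<kappa>)) + \<phi> (\<zeta> - of_real t * (\<i> * \<kappa>))"
  shows "2 * pi * \<phi> 0 \<le> integral {0..2 * pi} (\<lambda>\<theta>. \<phi> (cis \<theta>))"
proof (rule field_le_epsilon)
  fix e :: real assume e: "e > 0"
  define \<epsilon> where "\<epsilon> = e / (2 * pi)"
  have \<epsilon>: "\<epsilon> > 0" "2 * pi * \<epsilon> = e" using e by (auto simp: \<epsilon>_def)
  let ?\<psi> = "\<lambda>\<theta>. \<phi> (cis \<theta>)"
  have cont\<psi>: "continuous_on S ?\<psi>" for S
    by (rule continuous_on_compose2[OF cont]) (auto intro!: continuous_intros)
  have "uniformly_continuous_on {0..2 * pi} ?\<psi>"
    by (intro compact_uniformly_continuous cont\<psi>) auto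
  then obtain \<delta> where \<delta>: "\<delta> > 0"
    "\<And>x y. x \<in> {0..2 * pi} \<Longrightarrow> y \<in> {0..2 * pi} \<Longrightarrow> dist x y < \<delta> \<Longrightarrow> dist (?\<psi> x) (?\<psi> y) < \<epsilon>"
    unfolding uniformly_continuous_on_def using \<epsilon>(1) by metis
  obtain n where n: "real n > 2 * pi / \<delta>" using reals_Archimedean2 by blast
  then have Npos: "n > 0" using \<delta>(1) pi_gt_zero
    by (metis divide_pos_pos gr0I less_asym mult_pos_pos of_nat_0 zero_less_numeral)
  define h where "h = 2 * pi / real n"
  have h: "h > 0" "h < \<delta>" "real n * h = 2 * pi" 
    using Npos n \<delta>(1) by (auto simp: h_def field_simps)
  define \<omega> where "\<omega> = cis h"
  have \<omega>: "cmod (\<omega> ^ k) = 1" "\<omega> ^ n = 1" "\<omega> ^ k = cis (real k * h)" for k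
    using h(3) by (simp_all add: \<omega>_def norm_power Complex.DeMoivre)
  define W where "W \<zeta> = (\<Sum>k<n. \<phi> (\<omega> ^ k * \<zeta>))" for \<zeta>
  \<comment> \<open>\<open>W\<close> is invariant under the roots of unity, so the angle of \<open>\<xi>\<close> may be reduced to \<open>[0, h)\<close> and the \<open>k\<close>-th sample point lies in the \<open>k\<close>-th subinterval.\<close>
  have W_rotate: "W (\<omega> ^ j * \<zeta>) = W \<zeta>" for j \<zeta>
  proof (induction j)
    case (Suc j)
    have shift: "W (\<omega> * \<eta>) = W \<eta>" for \<eta>
    proof -
      have "W (\<omega> * \<eta>) + \<phi> \<eta> = (\<Sum>k<n. \<phi> (\<omega> ^ Suc k * \<eta>)) + \<phi> (\<omega> ^ 0 * \<eta>)"
        by (simp add: W_def mult_ac)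
      also have "\<dots> = (\<Sum>k<Suc n. \<phi> (\<omega> ^ k * \<eta>))"
        by (subst sum.lessThan_Suc_shift) simp
      also have "\<dots> = W \<eta> + \<phi> \<eta>" using \<omega>(2) by (simp add: W_def)
      finally show ?thesis by simp
    qed
    show ?case using Suc shift[of "\<omega> ^ j * \<zeta>"] by (simp add: mult_ac)
  qed simp
  have "continuous_on (cball 0 1) W"
    unfolding W_def
  proof (intro continuous_on_sum)
    fix k
    show "continuous_on (cball 0 1) (\<lambda>\<zeta>. \<phi> (\<omega> ^ k * \<zeta>))"
      by (rule continuous_on_compose2[OF cont]) (auto intro!: continuous_intros simp: norm_mult \<omega>(1))
  qed
  then obtain \<xi> where \<xi>: "cmod \<xi> = 1" "W 0 \<le> W \<xi>"
  proof (rule strict_max_principle_disc)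
    fix \<zeta> :: complex assume \<zeta>: "\<zeta> \<in> ball 0 1"
    have "\<forall>\<^sub>F t in at_right 0. \<forall>k\<in>{..<n}.
        4 * \<phi> (\<omega> ^ k * \<zeta>) < \<phi> (\<omega> ^ k * \<zeta> + of_real t * \<omega> ^ k) + \<phi> (\<omega> ^ k * \<zeta> - of_real t * \<omega> ^ k)
          + \<phi> (\<omega> ^ k * \<zeta> + of_real t * (\<i> * \<omega> ^ k)) + \<phi> (\<omega> ^ k * \<zeta> - of_real t * (\<i> * \<omega> ^ k))"
      using \<zeta> by (intro eventually_ball_finite finite_lessThan ballI four) (auto simp: norm_mult \<omega>(1))
    then show "\<forall>\<^sub>F t in at_right 0.
        4 * W \<zeta> < W (\<zeta> + of_real t) + W (\<zeta> - of_real t) + W (\<zeta> + of_real t * \<i>) + W (\<zeta> - of_real t * \<i>)"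
    proof eventually_elim
      case (elim t)
      have "(\<Sum>k<n. 4 * \<phi> (\<omega> ^ k * \<zeta>)) < (\<Sum>k<n. \<phi> (\<omega> ^ k * (\<zeta> + of_real t)) + \<phi> (\<omega> ^ k * (\<zeta> - of_real t))
          + \<phi> (\<omega> ^ k * (\<zeta> + of_real t * \<i>)) + \<phi> (\<omega> ^ k * (\<zeta> - of_real t * \<i>)))"
        using Npos elim by (intro sum_strict_mono) (auto simp: algebra_simps)
      then show ?case by (simp add: W_def sum.distrib sum_distrib_left)
    qed
  qed
  obtain \<alpha> where \<alpha>: "0 \<le> \<alpha>" "\<xi> = cis \<alpha>"
  proof -
    have "\<xi> = cis (Arg2pi \<xi>)" using \<xi>(1) Arg2pi_eq[of \<xi>] by (simp add: cis_conv_exp mult.commute)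
    then show ?thesis using that Arg2pi_ge_0 by blast
  qed
  define j where "j = nat \<lfloor>\<alpha> / h\<rfloor>"
  define \<beta> where "\<beta> = \<alpha> - real j * h"
  have \<beta>: "0 \<le> \<beta>" "\<beta> < h"
  proof -
    have "real j = of_int \<lfloor>\<alpha> / h\<rfloor>" using \<alpha>(1) h(1) by (simp add: j_def)
    then have "real j \<le> \<alpha> / h" "\<alpha> / h < real j + 1" by linarith+
    then show "0 \<le> \<beta>" "\<beta> < h" using h(1) by (simp_all add: \<beta>_def field_simps)
  qed
  have "\<xi> = \<omega> ^ j * cis \<beta>" by (simp add: \<omega>(3) \<alpha>(2) cis_mult \<beta>_def)
  then have W\<xi>: "W \<xi> = (\<Sum>k<n. ?\<psi> (real k * h + \<beta>))"
    using W_rotate[of j "cis \<beta>"] by (simp add: W_def \<omega>(3) cis_mult)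
  have "W \<xi> * h \<le> integral {0..real n * h} (\<lambda>\<theta>. ?\<psi> \<theta> + \<epsilon>)"
    unfolding W\<xi>
  proof (rule lower_sum_le_integral[where N = n])
    show "continuous_on {0..real n * h} (\<lambda>\<theta>. ?\<psi> \<theta> + \<epsilon>)" by (intro continuous_intros cont\<psi>)
    fix k \<theta> assume k: "k < n" and \<theta>: "\<theta> \<in> {real k * h..real (Suc k) * h}"
    have "0 \<le> real k * h" "real (Suc k) * h \<le> real n * h" using k h(1) by (auto intro!: mult_right_mono)
    moreover have "real (Suc k) * h = real k * h + h" by (simp add: algebra_simps)
    ultimately have "real k * h + \<beta> \<in> {0..2 * pi}" "\<theta> \<in> {0..2 * pi}" "dist (real k * h + \<beta>) \<theta> < \<delta>"
      using \<theta> \<beta> h unfolding dist_real_def atLeastAtMost_iff by linarith+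
    then have "dist (?\<psi> (real k * h + \<beta>)) (?\<psi> \<theta>) < \<epsilon>" by (rule \<delta>(2))
    then show "?\<psi> (real k * h + \<beta>) \<le> ?\<psi> \<theta> + \<epsilon>" unfolding dist_real_def by linarith
  qed (use h in auto)
  also have "\<dots> = integral {0..2 * pi} ?\<psi> + e"
    unfolding h(3) using \<epsilon>(2) 
    by (subst integral_add) (auto intro!: integrable_continuous_real cont\<psi>)
  finally have "W \<xi> * h \<le> integral {0..2 * pi} ?\<psi> + e" .
  moreover have "2 * pi * \<phi> 0 = W 0 * h" using h(3) by (simp add: W_def algebra_simps)
  moreover have "W 0 * h \<le> W \<xi> * h" using \<xi>(2) h(1) by simp
  ultimately show "2 * pi * \<phi> 0 \<le> integral {0..2 * pi} ?\<psi> + e" by linarith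
qed

text \<open>On each complex line through a point this is the corresponding statement for the unit disc.\<close>

lemma psh_of_strict_four_point:
  fixes v :: "'a::complex_hilbert \<Rightarrow> real"
  assumes v: "continuous_on G v"
    and four: "\<And>p k. p \<in> G \<Longrightarrow> k \<noteq> 0 \<Longrightarrow> \<forall>\<^sub>F t in at_right 0. 4 * v p < v (p + t *\<^sub>R k) + v (p - t *\<^sub>R k)
    + v (p + t *\<^sub>R (\<i> *\<^sub>C k)) + v (p - t *\<^sub>R (\<i> *\<^sub>C k))"
  shows "psh G (\<lambda>z. ereal (v z))"
  unfolding psh_def
proof (intro conjI ballI allI impI)
  show "usc_on G (\<lambda>z. ereal (v z))"
    unfolding usc_on_def
  proof
    fix c :: ereal
    have "continuous_on G (\<lambda>z. ereal (v z))" by (intro continuous_intros v)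
    then have "openin (top_of_set G) (G \<inter> (\<lambda>z. ereal (v z)) -` {..<c})"
      by (rule continuous_openin_preimage_gen) simp
    then show "openin (top_of_set G) {z \<in> G. ereal (v z) < c}" by (simp add: vimage_def Int_def)
  qed
  show "\<exists>z\<in>C. ereal (v z) \<noteq> - \<infinity>" if "C \<in> components G" for C
    using in_components_nonempty[OF that] by auto
  fix z h assume z: "z \<in> G" and disc: "\<forall>\<zeta>. cmod \<zeta> \<le> 1 \<longrightarrow> z + \<zeta> *\<^sub>C h \<in> G"
  note cont = continuous_on_circle[OF v disc[rule_format]]
  have "2 * pi * v z \<le> integral {0..2 * pi} (\<lambda>\<theta>. v (z + cis \<theta> *\<^sub>C h))"
  proof (cases "h = 0")
    case True
    then have "cis \<theta> *\<^sub>C h = 0" for \<theta> by (metis norm_eq_zero norm_scaleC mult_zero_right)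
    then show ?thesis by simp
  next
    case False
    have "2 * pi * v (z + 0 *\<^sub>C h) \<le> integral {0..2 * pi} (\<lambda>\<theta>. v (z + cis \<theta> *\<^sub>C h))"
    proof (rule strict_four_point_submean_disc[OF cont(1)])
      fix \<zeta> \<kappa> :: complex assume \<zeta>: "\<zeta> \<in> ball 0 1" and \<kappa>: "cmod \<kappa> = 1"
      have "z + \<zeta> *\<^sub>C h \<in> G" using \<zeta> disc by simp
      moreover have "\<kappa> *\<^sub>C h \<noteq> 0" using False \<kappa> by (metis norm_eq_zero norm_scaleC mult_1)
      ultimately have ev: "\<forall>\<^sub>F t in at_right 0. 4 * v (z + \<zeta> *\<^sub>C h) < v (z + \<zeta> *\<^sub>C h + t *\<^sub>R (\<kappa> *\<^sub>C h)) + v (z + \<zeta> *\<^sub>C h - t *\<^sub>R (\<kappa> *\<^sub>C h))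
        + v (z + \<zeta> *\<^sub>C h + t *\<^sub>R (\<i> *\<^sub>C \<kappa> *\<^sub>C h)) + v (z + \<zeta> *\<^sub>C h - t *\<^sub>R (\<i> *\<^sub>C \<kappa> *\<^sub>C h))"
        by (rule four)
      interpret S: bounded_linear "\<lambda>c. c *\<^sub>C h" by (rule bounded_linear_scaleC_left)
      have shift: "z + (\<zeta> + of_real t * c) *\<^sub>C h = z + \<zeta> *\<^sub>C h + t *\<^sub>R (c *\<^sub>C h)"
           "z + (\<zeta> - of_real t * c) *\<^sub>C h = z + \<zeta> *\<^sub>C h - t *\<^sub>R (c *\<^sub>C h)" for t c
        by (simp_all add: S.add S.diff scaleR_eq_scaleC scaleC_scaleC algebra_simps)
      show "\<forall>\<^sub>F t in at_right 0. 4 * v (z + \<zeta> *\<^sub>C h)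
          < v (z + (\<zeta> + of_real t * \<kappa>) *\<^sub>C h) + v (z + (\<zeta> - of_real t * \<kappa>) *\<^sub>C h)
          + v (z + (\<zeta> + of_real t * (\<i> * \<kappa>)) *\<^sub>C h) + v (z + (\<zeta> - of_real t * (\<i> * \<kappa>)) *\<^sub>C h)"
        using ev by (simp only: shift scaleC_scaleC)
    qed
    moreover have "0 *\<^sub>C h = 0" by (metis norm_eq_zero norm_scaleC norm_zero mult_zero_left)
    ultimately show ?thesis by simp
  qed
  then have "v z \<le> 1 / (2 * pi) * integral {0..2 * pi} (\<lambda>\<theta>. v (z + cis \<theta> *\<^sub>C h))"
    by (simp add: field_simps)
  then show "ereal (v z) \<le> ereal (1 / (2 * pi)) *
      ereal_integral (restrict_space lborel {0..2 * pi}) (\<lambda>\<theta>. ereal (v (z + cis \<theta> *\<^sub>C h)))"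
    by (simp add: ereal_integral_continuous[OF cont(2)])
qed simp


section \<open>Maximality forbids a coercive Levi operator\<close>

text \<open>The second-order part of the four-point sum of \<open>u\<close> is \<open>4 t\<^sup>2\<close> times the Levi form, hence at least
  \<open>8 c t\<^sup>2 \<parallel>k\<parallel>\<^sup>2\<close>. The Taylor error with constant \<open>c / 2\<close> costs \<open>2 c t\<^sup>2 \<parallel>k\<parallel>\<^sup>2\<close> and the subtracted
  squared norm \<open>4 c t\<^sup>2 \<parallel>k\<parallel>\<^sup>2\<close>, which leaves a positive rest.\<close>

lemma four_point_perturbed:
  fixes u :: "'a::complex_hilbert \<Rightarrow> real" and a :: 'a and r :: real
  assumes \<Omega>: "open \<Omega>" and u: "C2_on \<Omega> u" and p: "p \<in> \<Omega>" and c: "c > 0" and k: "k \<noteq> 0"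
    and levi: "2 * c * (norm k)\<^sup>2 \<le> inner (levi_op u p k) k"
  defines "v \<equiv> \<lambda>z. u z + c * (r\<^sup>2 - (norm (z - a))\<^sup>2)"
  shows "\<forall>\<^sub>F t in at_right 0. 4 * v p < v (p + t *\<^sub>R k) + v (p - t *\<^sub>R k)
    + v (p + t *\<^sub>R (\<i> *\<^sub>C k)) + v (p - t *\<^sub>R (\<i> *\<^sub>C k))"
proof -
  obtain d where d: "d > 0"
    "\<And>k. norm k < d \<Longrightarrow> \<bar>u (p + k) - u p - D1 u p k - D2 u p k k / 2\<bar> \<le> (c / 2) * (norm k)\<^sup>2"
    by (rule taylor2[OF \<Omega> u p half_gt_zero[OF c]]) blast
  have "\<forall>\<^sub>F t in at_right 0. t \<in> {0<..<d / norm k}"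
    using d(1) k by (intro eventually_at_right_real) simp
  then show ?thesis
  proof eventually_elim
    case (elim t)
    then have t: "t > 0" "t * norm k < d" using k by (auto simp: field_simps)
    have sym: "2 * u p + t\<^sup>2 * D2 u p w w - c * (t\<^sup>2 * (norm k)\<^sup>2) \<le> u (p + t *\<^sub>R w) + u (p - t *\<^sub>R w)"
      if w: "norm w = norm k" for w
    proof -
      have "norm (t *\<^sub>R w) < d" "norm (- (t *\<^sub>R w)) < d" using t w by simp_all
      from d(2)[OF this(1)] d(2)[OF this(2)]
      have "\<bar>u (p + t *\<^sub>R w) - u p - t * D1 u p w - t\<^sup>2 * D2 u p w w / 2\<bar> \<le> (c / 2) * (t\<^sup>2 * (norm k)\<^sup>2)"
        "\<bar>u (p - t *\<^sub>R w) - u p + t * D1 u p w - t\<^sup>2 * D2 u p w w / 2\<bar> \<le> (c / 2) * (t\<^sup>2 * (norm k)\<^sup>2)"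
        using t w by (simp_all add: blinfun.bilinear_simps power2_eq_square mult_ac)
      then show ?thesis by linarith
    qed
    have quad: "(norm (p + t *\<^sub>R w - a))\<^sup>2 + (norm (p - t *\<^sub>R w - a))\<^sup>2 = 2 * (norm (p - a))\<^sup>2 + 2 * (t\<^sup>2 * (norm k)\<^sup>2)"
      if w: "norm w = norm k" for w
    proof -
      have "(norm (p + t *\<^sub>R w - a))\<^sup>2 + (norm (p - t *\<^sub>R w - a))\<^sup>2
          = (norm ((p - a) + t *\<^sub>R w))\<^sup>2 + (norm ((p - a) - t *\<^sub>R w))\<^sup>2" by (simp add: algebra_simps)
      also have "\<dots> = 2 * (norm (p - a))\<^sup>2 + 2 * (norm (t *\<^sub>R w))\<^sup>2"
        by (simp add: power2_norm_eq_inner inner_add_left inner_add_right inner_diff_left inner_diff_right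
            algebra_simps del: norm_scaleR)
      finally show ?thesis using w by (simp add: power_mult_distrib)
    qed
    define N where "N = t\<^sup>2 * (norm k)\<^sup>2"
    have N: "N > 0" using t k by (simp add: N_def)
    have "t\<^sup>2 * (2 * c * (norm k)\<^sup>2) \<le> t\<^sup>2 * inner (levi_op u p k) k" using levi by (intro mult_left_mono) auto
    then have lev: "8 * (c * N) \<le> t\<^sup>2 * D2 u p k k + t\<^sup>2 * D2 u p (\<i> *\<^sub>C k) (\<i> *\<^sub>C k)"
      by (simp add: levi_op_inner N_def algebra_simps)
    have "4 * v p + 2 * (c * N) \<le> v (p + t *\<^sub>R k) + v (p - t *\<^sub>R k)
        + v (p + t *\<^sub>R (\<i> *\<^sub>C k)) + v (p - t *\<^sub>R (\<i> *\<^sub>C k))"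
    proof -
      have v2: "v (p + t *\<^sub>R w) + v (p - t *\<^sub>R w) = u (p + t *\<^sub>R w) + u (p - t *\<^sub>R w) + 2 * (c * r\<^sup>2) - 2 * (c * (norm (p - a))\<^sup>2) - 2 * (c * N)"
        if "norm w = norm k" for w
      proof -
        have "v (p + t *\<^sub>R w) + v (p - t *\<^sub>R w) = u (p + t *\<^sub>R w) + u (p - t *\<^sub>R w) + 2 * (c * r\<^sup>2)
          - c * ((norm (p + t *\<^sub>R w - a))\<^sup>2 + (norm (p - t *\<^sub>R w - a))\<^sup>2)"
          by (simp add: v_def algebra_simps)
        then show ?thesis unfolding quad[OF that] N_def by (simp add: algebra_simps)
      qed
      have "norm (\<i> *\<^sub>C k) = norm k" by simp
      from v2[OF this] sym[OF this] v2[OF refl] sym[OF refl] lev show ?thesis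
        unfolding N_def[symmetric] by (simp add: v_def algebra_simps)
    qed
    moreover have "c * N > 0" using c N by simp
    ultimately show ?case by linarith
  qed
qed

text \<open>Otherwise the Levi operator would be coercive near \<open>a\<close>, and adding a small multiple of
  \<open>r\<^sup>2 - \<parallel>z - a\<parallel>\<^sup>2\<close> would produce a competitor that beats \<open>u\<close> at \<open>a\<close>. If the space is trivial, the
  assumption for contradiction holds vacuously and the same competitor works, so the lemma also shows
  that the space contains a unit vector.\<close>

lemma maximal_psh_levi_op_not_coercive:
  fixes u :: "'a::complex_hilbert \<Rightarrow> real"
  assumes \<Omega>: "open \<Omega>" and u: "C2_on \<Omega> u" and max: "maximal_psh \<Omega> (\<lambda>z. ereal (u z))"
    and a: "a \<in> \<Omega>" and c: "c > 0"
  shows "\<exists>x. norm x = 1 \<and> inner (levi_op u a x) x < c"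
proof (rule ccontr)
  assume "\<not> ?thesis"
  then have unit: "c \<le> inner (levi_op u a x) x" if "norm x = 1" for x
    using that by force
  have "c * (norm x)\<^sup>2 \<le> inner (levi_op u a x) x" for x
  proof (cases "x = 0")
    case False
    have "c * (norm x)\<^sup>2 \<le> inner (levi_op u a (sgn x)) (sgn x) * (norm x)\<^sup>2"
      using unit[of "sgn x"] False by (intro mult_right_mono) (auto simp: norm_sgn)
    also have "\<dots> = inner (levi_op u a x) x"
      using False by (simp add: sgn_div_norm blinfun.bilinear_simps power2_eq_square field_simps)
    finally show ?thesis .
  qed simp
  then obtain r where r: "r > 0" "cball a r \<subseteq> \<Omega>"
    "\<And>p x. p \<in> cball a r \<Longrightarrow> c / 2 * (norm x)\<^sup>2 \<le> inner (levi_op u p x) x"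
    by (rule levi_op_lower_bound_nearby[OF \<Omega> u a c]) blast
  \<comment> \<open>The factor \<open>c / 4\<close> is half of the remaining lower bound \<open>c / 2\<close>, which keeps the four-point inequality strict.\<close>
  define v where "v z = u z + c / 4 * (r\<^sup>2 - (norm (z - a))\<^sup>2)" for z
  have contv: "continuous_on \<Omega> v"
    unfolding v_def by (intro continuous_intros C2_on_continuous[OF u])
  let ?G = "ball a r"
  have psh: "psh ?G (\<lambda>z. ereal (v z))"
  proof (rule psh_of_strict_four_point)
    show "continuous_on ?G v" using contv by (rule continuous_on_subset) (use r in auto)
    fix p k :: 'a assume p: "p \<in> ?G" and k: "k \<noteq> 0"
    show "\<forall>\<^sub>F t in at_right 0. 4 * v p < v (p + t *\<^sub>R k) + v (p - t *\<^sub>R k)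
      + v (p + t *\<^sub>R (\<i> *\<^sub>C k)) + v (p - t *\<^sub>R (\<i> *\<^sub>C k))"
      unfolding v_def
      by (rule four_point_perturbed[OF \<Omega> u _ _ k]) (use p r c r(3)[of p k] in auto)
  qed
  have closure: "closure ?G \<subseteq> cball a r" by (simp add: closure_minimal)
  have boundary: "Limsup (at \<xi> within ?G) (\<lambda>z. ereal (v z)) \<le> ereal (u \<xi>)" if \<xi>: "\<xi> \<in> frontier ?G" for \<xi>
  proof -
    have "\<xi> \<in> cball a r" "\<xi> \<notin> ball a r" using \<xi> closure by (auto simp: frontier_def)
    then have \<xi>\<Omega>: "\<xi> \<in> \<Omega>" and v\<xi>: "v \<xi> = u \<xi>"
      using r(2) by (auto simp: v_def dist_norm norm_minus_commute)
    have "isCont v \<xi>" using contv \<Omega> \<xi>\<Omega> by (simp add: continuous_on_eq_continuous_at)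
    then have lim: "((\<lambda>z. ereal (v z)) \<longlongrightarrow> ereal (u \<xi>)) (at \<xi> within ?G)"
      unfolding v\<xi>[symmetric] isCont_def by (intro tendsto_ereal) (rule tendsto_within_subset[of _ _ _ UNIV], auto)
    show ?thesis
      by (rule Limsup_le_iff[THEN iffD2]) (use lim in \<open>auto intro: order_tendstoD\<close>)
  qed
  have "\<forall>z\<in>?G. ereal (v z) \<le> ereal (u z)"
    using max[unfolded maximal_psh_def, THEN conjunct2, rule_format, of ?G "\<lambda>z. ereal (v z)"]
      psh boundary closure r(2) by auto
  then have "v a \<le> u a" using r(1) by simp
  then show False using r(1) c by (simp add: v_def mult_le_0_iff)
qed


section \<open>Polynomials of a symmetric operator\<close>

definition symmetric_op :: "('a::real_inner \<Rightarrow>\<^sub>L 'a) \<Rightarrow> bool" where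
  "symmetric_op A \<longleftrightarrow> (\<forall>x y. inner (A x) y = inner x (A y))"

definition bounded_below :: "('a::real_normed_vector \<Rightarrow>\<^sub>L 'b::real_normed_vector) \<Rightarrow> bool" where
  "bounded_below A \<longleftrightarrow> (\<exists>c>0. \<forall>x. c * norm x \<le> norm (A x))"

text \<open>Only real points of the spectrum enter the functional calculus, and for a real scalar the
  resolvent condition involves real scaling alone.\<close>

definition real_spectrum :: "('a::complex_hilbert \<Rightarrow>\<^sub>L 'a) \<Rightarrow> real set" where
  "real_spectrum A = {r. complex_of_real r \<in> op_spectrum A}"

lemma not_in_real_spectrum_iff:
  "r \<notin> real_spectrum A \<longleftrightarrow>
     (\<exists>B :: 'a::complex_hilbert \<Rightarrow>\<^sub>L 'a. \<forall>x. B (A x - r *\<^sub>R x) = x \<and> A (B x) - r *\<^sub>R B x = x)"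
  by (simp add: real_spectrum_def op_spectrum_def scaleR_eq_scaleC)

lemma poly_op_0 [simp]: "poly_op 0 A = 0"
  by (simp add: poly_op_def)

lemma poly_op_pCons:
  "poly_op (pCons c p) A = c *\<^sub>R id_blinfun + (A o\<^sub>L poly_op p A)"
proof (cases "p = 0")
  case True
  then show ?thesis
    by (simp add: poly_op_def bounded_bilinear.zero_right[OF bounded_bilinear_blinfun_compose])
next
  case False
  then have "poly_op (pCons c p) A = (\<Sum>i\<le>Suc (degree p). coeff (pCons c p) i *\<^sub>R (((o\<^sub>L) A) ^^ i) id_blinfun)"
    by (simp add: poly_op_def)
  also have "\<dots> = c *\<^sub>R id_blinfun + (\<Sum>i\<le>degree p. coeff p i *\<^sub>R (A o\<^sub>L (((o\<^sub>L) A) ^^ i) id_blinfun))"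
    by (subst sum.atMost_Suc_shift) simp
  also have "\<dots> = c *\<^sub>R id_blinfun + (A o\<^sub>L poly_op p A)"
    by (simp add: poly_op_def bounded_bilinear.sum_right[OF bounded_bilinear_blinfun_compose]
        bounded_bilinear.scaleR_right[OF bounded_bilinear_blinfun_compose])
  finally show ?thesis .
qed

lemma poly_op_pCons_apply [simp]:
  "poly_op (pCons c p) A x = c *\<^sub>R x + A (poly_op p A x)"
  by (simp add: poly_op_pCons blinfun.add_left blinfun.scaleR_left)

lemma poly_op_add: "poly_op (p + q) A x = poly_op p A x + poly_op q A x"
  by (induction p q rule: poly_induct2) (simp_all add: algebra_simps blinfun.bilinear_simps)

lemma poly_op_smult: "poly_op (smult c p) A x = c *\<^sub>R poly_op p A x"
  by (induction p) (simp_all add: algebra_simps blinfun.bilinear_simps)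

lemma poly_op_diff: "poly_op (p - q) A x = poly_op p A x - poly_op q A x"
  using poly_op_add[of p "- q" A x] poly_op_smult[of "-1" q A x] by simp

lemma poly_op_mult: "poly_op (p * q) A x = poly_op p A (poly_op q A x)"
  by (induction p) (simp_all add: algebra_simps blinfun.bilinear_simps poly_op_add poly_op_smult)

lemma poly_op_translate: "poly_op (p \<circ>\<^sub>p [:c, 1:]) A x = poly_op p (A + c *\<^sub>R id_blinfun) x"
  by (induction p arbitrary: x)
    (simp_all add: pcompose_pCons poly_op_add poly_op_mult poly_op_smult algebra_simps blinfun.bilinear_simps)

lemma symmetric_poly_op: "symmetric_op A \<Longrightarrow> symmetric_op (poly_op p A)"
proof (induction p)
  case (pCons c p)
  have comm: "A (poly_op p A x) = poly_op p A (A x)" for x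
  proof -
    have "A (poly_op p A x) = poly_op ([:0,1:] * p) A x" by (simp add: poly_op_mult)
    also have "\<dots> = poly_op (p * [:0,1:]) A x" by (simp add: mult.commute)
    also have "\<dots> = poly_op p A (A x)" by (simp only: poly_op_mult) simp
    finally show ?thesis .
  qed
  show ?case
    using pCons.IH[OF pCons.prems] pCons.prems comm
    by (auto simp: symmetric_op_def inner_add_left inner_add_right)
qed (simp add: symmetric_op_def)


section \<open>Spectral mapping and positivity\<close>

lemma bounded_below_compose:
  fixes C :: "_ \<Rightarrow>\<^sub>L _"
  assumes "bounded_below A" "bounded_below B" "\<And>x. C x = A (B x)"
  shows "bounded_below C"
proof -
  obtain a b where a: "a > 0" "\<And>x. a * norm x \<le> norm (A x)" and b: "b > 0" "\<And>x. b * norm x \<le> norm (B x)"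
    using assms(1,2) unfolding bounded_below_def by blast
  have "(a * b) * norm x \<le> norm (C x)" for x
  proof -
    have "a * (b * norm x) \<le> a * norm (B x)" using a(1) b(2) by simp
    also have "\<dots> \<le> norm (C x)" using a(2) assms(3) by simp
    finally show ?thesis by (simp add: mult.assoc)
  qed
  then show ?thesis unfolding bounded_below_def using a b by (intro exI[of _ "a*b"]) auto
qed

text \<open>A left inverse bounds the operator from below by the reciprocal of its norm.\<close>

lemma bounded_below_off_spectrum:
  assumes "r \<notin> real_spectrum A"
  shows "bounded_below (poly_op [:-r, 1:] A)"
proof -
  obtain B :: "'a \<Rightarrow>\<^sub>L 'a" where B: "\<And>x. B (A x - r *\<^sub>R x) = x"
    using assms unfolding not_in_real_spectrum_iff by blast
  have "inverse (norm B + 1) * norm x \<le> norm (poly_op [:-r, 1:] A x)" for x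
  proof -
    have "norm x = norm (B (A x - r *\<^sub>R x))" using B by simp
    also have "\<dots> \<le> norm B * norm (A x - r *\<^sub>R x)" by (rule norm_blinfun)
    also have "\<dots> \<le> (norm B + 1) * norm (A x - r *\<^sub>R x)" by (simp add: mult_right_mono)
    finally have "norm x \<le> (norm B + 1) * norm (poly_op [:-r, 1:] A x)"
      by (simp add: algebra_simps)
    then show ?thesis
      by (simp add: field_simps add_pos_nonneg)
  qed
  moreover have "inverse (norm B + 1) > 0" by (simp add: add_nonneg_pos)
  ultimately show ?thesis unfolding bounded_below_def by blast
qed

text \<open>The polynomial is \<open>(X - a)\<^sup>2 + b\<^sup>2\<close>, and the square of a symmetric operator is positive.\<close>

lemma bounded_below_quadratic:
  assumes A: "symmetric_op A" and b: "b \<noteq> 0"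
  shows "bounded_below (poly_op [:a\<^sup>2 + b\<^sup>2, -2*a, 1:] A)"
proof -
  have "b\<^sup>2 * norm x \<le> norm (poly_op [:a\<^sup>2 + b\<^sup>2, -2*a, 1:] A x)" for x
  proof (cases "x = 0")
    case False
    let ?q = "poly_op [:a\<^sup>2 + b\<^sup>2, -2*a, 1:] A x"
    have "?q = (A (A x - a *\<^sub>R x) - a *\<^sub>R (A x - a *\<^sub>R x)) + b\<^sup>2 *\<^sub>R x"
      by (simp add: algebra_simps blinfun.bilinear_simps power2_eq_square flip: scaleR_2)
    then have "inner ?q x = inner (A x - a *\<^sub>R x) (A x - a *\<^sub>R x) + b\<^sup>2 * inner x x"
      using A by (simp add: symmetric_op_def inner_add_left inner_add_right inner_diff_left inner_diff_right)
    then have "b\<^sup>2 * (norm x)\<^sup>2 \<le> inner ?q x"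
      by (simp add: power2_norm_eq_inner)
    also have "\<dots> \<le> norm ?q * norm x" by (rule norm_cauchy_schwarz)
    finally have "(b\<^sup>2 * norm x) * norm x \<le> norm ?q * norm x" by (simp add: power2_eq_square)
    then show ?thesis using False by simp
  qed simp
  then show ?thesis unfolding bounded_below_def using b by (intro exI[of _ "b\<^sup>2"]) auto
qed

lemma poly_map_of_real_add_mult:
  fixes z :: complex
  shows "poly (map_poly of_real (p + q)) z = poly (map_poly of_real p) z + poly (map_poly of_real q) z"
    and "poly (map_poly of_real (p * q)) z = poly (map_poly of_real p) z * poly (map_poly of_real q) z"
proof -
  have add: "poly (map_poly of_real (p + q)) z = poly (map_poly of_real p) z + poly (map_poly of_real q) z" for p q
    by (induction p q rule: poly_induct2) (simp_all add: map_poly_pCons algebra_simps)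
  have smult: "poly (map_poly of_real (smult c q)) z = of_real c * poly (map_poly of_real q) z" for c q
    by (induction q) (simp_all add: map_poly_pCons algebra_simps)
  show "poly (map_poly of_real (p + q)) z = poly (map_poly of_real p) z + poly (map_poly of_real q) z"
    by (rule add)
  show "poly (map_poly of_real (p * q)) z = poly (map_poly of_real p) z * poly (map_poly of_real q) z"
    by (induction p) (simp_all add: map_poly_pCons algebra_simps add smult)
qed

lemma poly_map_of_real_of_real:
  "poly (map_poly of_real p) (of_real r) = complex_of_real (poly p r)"
  by (induction p) (simp_all add: map_poly_pCons)

text \<open>A complex root \<open>z\<close> exists. If it is not real, then \<open>q\<close> is divisible by \<open>(X - z) (X - cnj z)\<close>,
  because the remainder is a real linear polynomial that vanishes at \<open>z\<close>.\<close>

lemma real_poly_linear_or_quadratic_factor: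
  fixes q :: "real poly"
  assumes "degree q \<noteq> 0"
  obtains (linear) r where "[:-r, 1:] dvd q" | (quadratic) a b where "b \<noteq> 0" "[:a\<^sup>2 + b\<^sup>2, -2*a, 1:] dvd q"
proof -
  let ?m = "map_poly complex_of_real"
  have deg: "degree (?m q) = degree q" by (simp add: degree_map_poly)
  have "\<exists>z. poly (?m q) z = 0"
  proof (rule fundamental_theorem_of_algebra_alt)
    show "\<not> (\<exists>a l. a \<noteq> 0 \<and> l = 0 \<and> ?m q = pCons a l)"
      using deg assms by force
  qed
  then obtain z where z: "poly (?m q) z = 0" by blast
  show ?thesis
  proof (cases "Im z = 0")
    case True
    then have zr: "z = complex_of_real (Re z)" by (simp add: complex_eq_iff)
    have "complex_of_real (poly q (Re z)) = 0" using z zr by (metis poly_map_of_real_of_real)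
    then have "[:-(Re z), 1:] dvd q" by (simp add: poly_eq_0_iff_dvd)
    then show ?thesis using that(1) by blast
  next
    case False
    let ?d = "[:(Re z)\<^sup>2 + (Im z)\<^sup>2, -2*Re z, 1:]"
    have dz: "poly (?m ?d) z = 0"
      by (simp add: map_poly_pCons complex_eq_iff power2_eq_square algebra_simps)
    have "degree (q mod ?d) < 2"
      using degree_mod_less[of ?d q] by auto
    then have "degree (q mod ?d) \<le> 1" by simp
    moreover obtain s k where sk: "q mod ?d = pCons s k" by (rule pCons_cases)
    ultimately have "degree k = 0" by (cases "k = 0") auto
    then obtain t where "k = [:t:]" by (rule degree_eq_zeroE)
    then have st: "q mod ?d = [:s, t:]" using sk by simp
    have "q = q div ?d * ?d + q mod ?d" by (rule div_mult_mod_eq[symmetric])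
    then have "poly (?m q) z = poly (?m (q div ?d)) z * poly (?m ?d) z + poly (?m (q mod ?d)) z"
      by (metis poly_map_of_real_add_mult)
    then have "poly (?m [:s, t:]) z = 0" using z dz st by simp
    then have "of_real s + z * of_real t = 0" by (simp add: map_poly_pCons)
    then have "t = 0" "s = 0" using False by (auto simp: complex_eq_iff)
    then have "?d dvd q" using st by (simp add: dvd_eq_mod_eq_0)
    then show ?thesis using that(2) False by blast
  qed
qed

text \<open>The half of the spectral mapping theorem that is needed, in contrapositive form: split off one
  linear or quadratic factor at a time, each of which is bounded below.\<close>

lemma bounded_below_poly_op:
  assumes A: "symmetric_op A"
  shows "q \<noteq> 0 \<Longrightarrow> (\<forall>r\<in>real_spectrum A. poly q r \<noteq> 0) \<Longrightarrow> bounded_below (poly_op q A)"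
proof (induction "degree q" arbitrary: q rule: less_induct)
  case less
  show ?case
  proof (cases "degree q = 0")
    case True
    then obtain c where "q = [:c:]" by (rule degree_eq_zeroE)
    then show ?thesis using less.prems(1) unfolding bounded_below_def
      by (intro exI[of _ "\<bar>c\<bar>"]) (auto simp: blinfun.bilinear_simps)
  next
    case False
    have step: "bounded_below (poly_op q A)"
      if q: "q = d * k" and d: "degree d > 0" "bounded_below (poly_op d A)" for d k
    proof -
      have "d \<noteq> 0" "k \<noteq> 0" using less.prems(1) q by auto
      then have "degree k < degree q" using q d by (simp add: degree_mult_eq)
      moreover have "\<forall>r\<in>real_spectrum A. poly k r \<noteq> 0" using less.prems(2) q by auto
      ultimately have "bounded_below (poly_op k A)" using less.hyps \<open>k \<noteq> 0\<close> by blast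
      then show ?thesis by (rule bounded_below_compose[OF d(2)]) (simp add: q poly_op_mult)
    qed
    from False show ?thesis
    proof (cases rule: real_poly_linear_or_quadratic_factor)
      case (linear r)
      then have "r \<notin> real_spectrum A" using less.prems(2) by (auto simp: poly_eq_0_iff_dvd)
      moreover obtain k where "q = [:-r, 1:] * k" using linear by blast
      ultimately show ?thesis using step[of "[:-r, 1:]" k] bounded_below_off_spectrum[of r A] by fastforce
    next
      case (quadratic a b)
      then obtain k where "q = [:a\<^sup>2 + b\<^sup>2, -2*a, 1:] * k" by blast
      then show ?thesis using step[of "[:a\<^sup>2 + b\<^sup>2, -2*a, 1:]" k] bounded_below_quadratic[OF A quadratic(1)] by fastforce
    qed
  qed
qed

text \<open>Evaluating the positive form at \<open>x - T x / K\<close> with \<open>K \<ge> \<parallel>T\<parallel>\<close> gives \<open>\<parallel>T x\<parallel>\<^sup>2 \<le> K \<langle>T x, x\<rangle>\<close>, a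
  substitute for the square root of \<open>T\<close>.\<close>

lemma positive_bounded_below_coercive:
  assumes T: "symmetric_op T" and pos: "\<And>x. 0 \<le> inner (T x) x" and bb: "bounded_below T"
  obtains d where "d > 0" "\<And>x. d * (norm x)\<^sup>2 \<le> inner (T x) x"
proof -
  obtain c where c: "c > 0" "\<And>x. c * norm x \<le> norm (T x)"
    using bb unfolding bounded_below_def by blast
  define K where "K = norm T + 1"
  have K: "K > 0" "norm T \<le> K" by (simp_all add: K_def add_nonneg_pos)
  have "(norm (T x))\<^sup>2 \<le> K * inner (T x) x" for x
  proof -
    have "inner (T (T x)) (T x) \<le> norm (T (T x)) * norm (T x)" by (rule norm_cauchy_schwarz)
    also have "\<dots> \<le> (norm T * norm (T x)) * norm (T x)" by (intro mult_right_mono norm_blinfun) simp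
    also have "\<dots> \<le> K * (norm (T x))\<^sup>2" using K(2) by (simp add: power2_eq_square mult_right_mono mult.assoc)
    finally have 1: "inner (T (T x)) (T x) \<le> K * (norm (T x))\<^sup>2" .
    have TT: "inner (T (T x)) x = inner (T x) (T x)"
      using T by (simp add: symmetric_op_def)
    let ?t = "inverse K"
    have "0 \<le> inner (T (x - ?t *\<^sub>R T x)) (x - ?t *\<^sub>R T x)" by (rule pos)
    also have "\<dots> = inner (T x) x - 2 * ?t * (norm (T x))\<^sup>2 + ?t\<^sup>2 * inner (T (T x)) (T x)"
      by (simp add: blinfun.bilinear_simps inner_diff_left inner_diff_right TT
          dot_square_norm power2_eq_square algebra_simps)
    also have "\<dots> \<le> inner (T x) x - 2 * ?t * (norm (T x))\<^sup>2 + ?t\<^sup>2 * (K * (norm (T x))\<^sup>2)"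
      using 1 by (intro add_left_mono mult_left_mono) auto
    also have "\<dots> = inner (T x) x - ?t * (norm (T x))\<^sup>2"
      using K by (simp add: power2_eq_square field_simps)
    finally show ?thesis using K by (simp add: field_simps)
  qed
  moreover have "c\<^sup>2 * (norm x)\<^sup>2 \<le> (norm (T x))\<^sup>2" for x
    using power_mono[OF c(2)[of x], of 2] c(1) by (simp add: power_mult_distrib)
  ultimately have "c\<^sup>2 * (norm x)\<^sup>2 \<le> K * inner (T x) x" for x
    using order_trans by blast
  then have "(c\<^sup>2 / K) * (norm x)\<^sup>2 \<le> inner (T x) x" for x
    using K by (simp add: field_simps)
  then show ?thesis using that[of "c\<^sup>2 / K"] c(1) K by simp
qed

text \<open>With \<open>m\<close> the infimum of the form of \<open>p(A)\<close> on the unit sphere, \<open>p(A) - m\<close> is positive but not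
  coercive, hence not bounded below, so \<open>p - m\<close> has a root in the spectrum. For \<open>p = X\<close> this shows
  that the spectrum is nonempty.\<close>

lemma spectrum_attains_lower_bound:
  fixes A :: "'a::complex_hilbert \<Rightarrow>\<^sub>L 'a"
  assumes A: "symmetric_op A" and x0: "(x0::'a) \<noteq> 0" and p: "degree p \<noteq> 0"
  obtains r where "r \<in> real_spectrum A" "\<And>x. poly p r * (norm x)\<^sup>2 \<le> inner (poly_op p A x) x"
proof -
  let ?B = "poly_op p A"
  define Q where "Q = (\<lambda>x. inner (?B x) x) ` sphere 0 1"
  define m where "m = Inf Q"
  have "bdd_below Q"
    unfolding Q_def
  proof (rule bdd_belowI2)
    fix x :: 'a assume "x \<in> sphere 0 1"
    then have x: "norm x = 1" by simp
    have "\<bar>inner (?B x) x\<bar> \<le> norm (?B x) * norm x" by (rule Cauchy_Schwarz_ineq2)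
    also have "\<dots> \<le> norm ?B" using norm_blinfun[of ?B x] x by simp
    finally show "- norm ?B \<le> inner (?B x) x" by simp
  qed
  have normalise: "inner (?B x) x = (norm x)\<^sup>2 * inner (?B (sgn x)) (sgn x)" for x
    by (cases "x = 0") (simp_all add: sgn_div_norm blinfun.bilinear_simps power2_eq_square field_simps)
  have Qne: "Q \<noteq> {}" using x0 norm_sgn[of x0] unfolding Q_def by (metis image_is_empty mem_sphere_0 empty_iff)
  have mle: "m * (norm x)\<^sup>2 \<le> inner (?B x) x" for x
  proof (cases "x = 0")
    case False
    then have "inner (?B (sgn x)) (sgn x) \<in> Q" unfolding Q_def by (simp add: norm_sgn)
    then have "m \<le> inner (?B (sgn x)) (sgn x)" unfolding m_def by (rule cInf_lower) fact
    then show ?thesis by (subst normalise) (simp add: mult.commute[of m] mult_left_mono)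
  qed simp
  let ?T = "poly_op (p - [:m:]) A"
  have Tq: "inner (?T x) x = inner (?B x) x - m * (norm x)\<^sup>2" for x
    by (simp add: poly_op_diff inner_diff_left power2_norm_eq_inner)
  have "\<not> bounded_below ?T"
  proof
    assume "bounded_below ?T"
    then obtain d where d: "d > 0" "\<And>x. d * (norm x)\<^sup>2 \<le> inner (?T x) x"
      using positive_bounded_below_coercive[OF symmetric_poly_op[OF A]] mle Tq
      by (metis diff_ge_0_iff_ge)
    have "m + d \<le> Inf Q"
    proof (rule cInf_greatest[OF Qne])
      fix y assume "y \<in> Q"
      then obtain x where x: "norm x = 1" "y = inner (?B x) x" unfolding Q_def by auto
      show "m + d \<le> y" using d(2)[of x] Tq[of x] x by simp
    qed
    then show False using d(1) m_def by simp
  qed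
  moreover have "p - [:m:] \<noteq> 0" using p by auto
  ultimately obtain r where "r \<in> real_spectrum A" "poly (p - [:m:]) r = 0"
    using bounded_below_poly_op[OF A] by blast
  then show ?thesis using that mle by simp
qed

text \<open>The infimum of the form is a value of \<open>p\<close> on the spectrum. A constant \<open>p\<close> is separate: there the
  hypothesis says something only because the spectrum is nonempty.\<close>

lemma poly_op_lower_bound:
  fixes A :: "'a::complex_hilbert \<Rightarrow>\<^sub>L 'a"
  assumes A: "symmetric_op A" and p: "\<And>r. r \<in> real_spectrum A \<Longrightarrow> c \<le> poly p r"
  shows "c * (norm x)\<^sup>2 \<le> inner (poly_op p A x) x"
proof (cases "x = 0")
  case False
  show ?thesis
  proof (cases "degree p = 0")
    case True
    then obtain k where k: "p = [:k:]" by (rule degree_eq_zeroE)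
    obtain r where "r \<in> real_spectrum A"
      using spectrum_attains_lower_bound[OF A False, of "[:0,1:]"] by auto
    then have "c \<le> k" using p k by auto
    then show ?thesis using k by (simp add: power2_norm_eq_inner mult_right_mono)
  next
    case pd: False
    obtain r where "r \<in> real_spectrum A" "poly p r * (norm x)\<^sup>2 \<le> inner (poly_op p A x) x"
      using spectrum_attains_lower_bound[OF A False pd] by metis
    then show ?thesis using p[of r] by (meson mult_right_mono order_trans zero_le_power2)
  qed
qed simp

text \<open>Positivity of \<open>e\<^sup>2 - p\<^sup>2\<close> on the spectrum, since \<open>\<parallel>p(A) x\<parallel>\<^sup>2 = \<langle>p(A)\<^sup>2 x, x\<rangle>\<close>.\<close>

lemma norm_poly_op_le:
  fixes A :: "'a::complex_hilbert \<Rightarrow>\<^sub>L 'a"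
  assumes A: "symmetric_op A" and p: "\<And>r. r \<in> real_spectrum A \<Longrightarrow> \<bar>poly p r\<bar> \<le> e" and e: "0 \<le> e"
  shows "norm (poly_op p A) \<le> e"
proof (rule norm_blinfun_bound[OF e])
  fix x
  have "0 * (norm x)\<^sup>2 \<le> inner (poly_op ([:e\<^sup>2:] - p * p) A x) x"
  proof (rule poly_op_lower_bound[OF A])
    fix r assume "r \<in> real_spectrum A"
    then have "\<bar>poly p r\<bar>\<^sup>2 \<le> e\<^sup>2" using p by (intro power_mono) auto
    then show "0 \<le> poly ([:e\<^sup>2:] - p * p) r" by (simp add: power2_eq_square)
  qed
  moreover have "inner (poly_op p A (poly_op p A x)) x = (norm (poly_op p A x))\<^sup>2"
    using symmetric_poly_op[OF A, of p] by (simp add: symmetric_op_def power2_norm_eq_inner)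
  ultimately have "(norm (poly_op p A x))\<^sup>2 \<le> (e * norm x)\<^sup>2"
    by (simp add: poly_op_diff poly_op_mult inner_diff_left power_mult_distrib power2_norm_eq_inner)
  then show "norm (poly_op p A x) \<le> e * norm x"
    by (rule power2_le_imp_le) (use e in simp)
qed


section \<open>Location of the spectrum\<close>

text \<open>For small \<open>t > 0\<close> the map \<open>x \<mapsto> x - t (T x - y)\<close> is a contraction whose fixed point solves
  \<open>T x = y\<close>.\<close>

lemma coercive_invertible:
  fixes T :: "'a::{real_inner,complete_space} \<Rightarrow>\<^sub>L 'a"
  assumes c: "c > 0" and T: "\<And>x. c * (norm x)\<^sup>2 \<le> inner (T x) x"
  obtains B :: "'a \<Rightarrow>\<^sub>L 'a" where "\<And>x. B (T x) = x" "\<And>x. T (B x) = x"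
proof -
  have low: "c * norm x \<le> norm (T x)" for x
  proof (cases "x = 0")
    case False
    have "c * (norm x)\<^sup>2 \<le> norm (T x) * norm x" using T norm_cauchy_schwarz order_trans by blast
    then show ?thesis using False by (simp add: power2_eq_square)
  qed simp
  define K where "K = norm T + 1"
  have K: "K > 0" by (simp add: K_def add_nonneg_pos)
  have normT: "norm (T x) \<le> K * norm x" for x
    using norm_blinfun[of T x] by (simp add: K_def distrib_right add_increasing2)
  \<comment> \<open>This \<open>t\<close> minimises the bound \<open>1 - 2 t c + t\<^sup>2 K\<^sup>2\<close> on the squared contraction factor.\<close>
  define t where "t = c / K\<^sup>2"
  \<comment> \<open>In the trivial space \<open>c\<close> may exceed \<open>K\<close>; the maximum with \<open>0\<close> covers that case.\<close>
  define k where "k = sqrt (max 0 (1 - c\<^sup>2 / K\<^sup>2))"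
  have t: "t > 0" using c K by (simp add: t_def)
  have contraction: "norm (x - t *\<^sub>R T x) \<le> k * norm x" for x
  proof -
    have "(norm (T x))\<^sup>2 \<le> (K * norm x)\<^sup>2"
      by (intro power_mono normT) auto
    then have "t\<^sup>2 * (norm (T x))\<^sup>2 \<le> t\<^sup>2 * (K * norm x)\<^sup>2" by (intro mult_left_mono) auto
    moreover have "t * (c * (norm x)\<^sup>2) \<le> t * inner (T x) x" using t T by (intro mult_left_mono) auto
    moreover have "(norm (x - t *\<^sub>R T x))\<^sup>2 = (norm x)\<^sup>2 - 2 * (t * inner (T x) x) + t\<^sup>2 * (norm (T x))\<^sup>2"
      by (simp add: power2_norm_eq_inner inner_diff_left inner_diff_right inner_commute[of x "T x"] power2_eq_square[of t] algebra_simps)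
    ultimately have "(norm (x - t *\<^sub>R T x))\<^sup>2 \<le> (norm x)\<^sup>2 - 2 * (t * (c * (norm x)\<^sup>2)) + t\<^sup>2 * (K * norm x)\<^sup>2"
      by linarith
    also have "\<dots> = (1 - c\<^sup>2 / K\<^sup>2) * (norm x)\<^sup>2"
      using K unfolding t_def by (simp add: field_simps power2_eq_square)
    also have "\<dots> \<le> max 0 (1 - c\<^sup>2 / K\<^sup>2) * (norm x)\<^sup>2" by (intro mult_right_mono) auto
    also have "\<dots> = (k * norm x)\<^sup>2" unfolding k_def by (simp add: power_mult_distrib)
    finally show ?thesis by (rule power2_le_imp_le) (simp add: k_def)
  qed
  have k: "0 \<le> k" "k < 1" using c K unfolding k_def by (auto simp: real_sqrt_lt_1_iff)
  have "\<exists>x. T x = y" for y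
  proof -
    have "\<exists>!x. x - t *\<^sub>R (T x - y) = x"
    proof (rule banach_fix_type[OF k], intro allI)
      fix x x'
      have "x - t *\<^sub>R (T x - y) - (x' - t *\<^sub>R (T x' - y)) = (x - x') - t *\<^sub>R T (x - x')"
        by (simp add: algebra_simps blinfun.bilinear_simps)
      then show "dist (x - t *\<^sub>R (T x - y)) (x' - t *\<^sub>R (T x' - y)) \<le> k * dist x x'"
        using contraction[of "x - x'"] by (simp only: dist_norm)
    qed
    then obtain x where "x - t *\<^sub>R (T x - y) = x" by blast
    then have "T x = y" using t by simp
    then show ?thesis by blast
  qed
  then obtain b where b: "\<And>y. T (b y) = y" by metis
  have inj: "x = x'" if "T x = T x'" for x x'
  proof -
    have "c * norm (x - x') \<le> 0" using low[of "x - x'"] that by (simp add: blinfun.diff_right)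
    then show ?thesis using c by (simp add: mult_le_0_iff)
  qed
  have "bounded_linear b"
  proof (rule bounded_linear_intro[where K = "inverse c"])
    show "b (x + y) = b x + b y" for x y by (rule inj) (simp add: b blinfun.add_right)
    show "b (r *\<^sub>R x) = r *\<^sub>R b x" for r x by (rule inj) (simp add: b blinfun.scaleR_right)
    show "norm (b x) \<le> norm x * inverse c" for x using low[of "b x"] c by (simp add: b field_simps)
  qed
  then have "Blinfun b y = b y" for y by (simp add: bounded_linear_Blinfun_apply)
  then show ?thesis using that[of "Blinfun b"] b inj by metis
qed

text \<open>Below \<open>c\<close> the operator \<open>A - r\<close> is coercive, and above the norm \<open>r - A\<close> is.\<close>

lemma real_spectrum_subset:
  fixes A :: "'a::complex_hilbert \<Rightarrow>\<^sub>L 'a"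
  assumes low: "\<And>x. c * (norm x)\<^sup>2 \<le> inner (A x) x"
  shows "real_spectrum A \<subseteq> {c..norm A}"
proof
  fix r assume r: "r \<in> real_spectrum A"
  have "c \<le> r"
  proof (rule ccontr)
    assume "\<not> c \<le> r"
    then have "(c - r) * (norm x)\<^sup>2 \<le> inner ((A - r *\<^sub>R id_blinfun) x) x" for x
      using low[of x] by (simp add: blinfun.bilinear_simps inner_diff_left power2_norm_eq_inner algebra_simps)
    then obtain B :: "'a \<Rightarrow>\<^sub>L 'a" where B: "\<And>x. B ((A - r *\<^sub>R id_blinfun) x) = x" "\<And>x. (A - r *\<^sub>R id_blinfun) (B x) = x"
      using coercive_invertible[of "c - r" "A - r *\<^sub>R id_blinfun"] \<open>\<not> c \<le> r\<close> by auto
    have "B (A x - r *\<^sub>R x) = x \<and> A (B x) - r *\<^sub>R B x = x" for x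
      using B(1)[of x] B(2)[of x] by (simp add: blinfun.bilinear_simps)
    then show False using r not_in_real_spectrum_iff[of r A] by blast
  qed
  moreover have "r \<le> norm A"
  proof (rule ccontr)
    assume "\<not> r \<le> norm A"
    have "inner (A x) x \<le> norm A * (norm x)\<^sup>2" for x
    proof -
      have "inner (A x) x \<le> norm (A x) * norm x" by (rule norm_cauchy_schwarz)
      also have "\<dots> \<le> (norm A * norm x) * norm x" by (intro mult_right_mono norm_blinfun) simp
      finally show ?thesis by (simp add: power2_eq_square)
    qed
    then have "(r - norm A) * (norm x)\<^sup>2 \<le> inner ((r *\<^sub>R id_blinfun - A) x) x" for x
      by (simp add: blinfun.bilinear_simps inner_diff_left power2_norm_eq_inner algebra_simps)
    then obtain B :: "'a \<Rightarrow>\<^sub>L 'a" where B: "\<And>x. B ((r *\<^sub>R id_blinfun - A) x) = x" "\<And>x. (r *\<^sub>R id_blinfun - A) (B x) = x"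
      using coercive_invertible[of "r - norm A" "r *\<^sub>R id_blinfun - A"] \<open>\<not> r \<le> norm A\<close> by auto
    have "(- B) (A x - r *\<^sub>R x) = x \<and> A ((- B) x) - r *\<^sub>R (- B) x = x" for x
      using B(1)[of x] B(2)[of x] by (simp add: blinfun.bilinear_simps)
    then show False using r not_in_real_spectrum_iff[of r A] by blast
  qed
  ultimately show "r \<in> {c..norm A}" by simp
qed

lemma real_spectrum_translate: "r \<in> real_spectrum (A + c *\<^sub>R id_blinfun) \<longleftrightarrow> r - c \<in> real_spectrum A"
proof -
  have "(A + c *\<^sub>R id_blinfun) x - r *\<^sub>R y = A x - (r - c) *\<^sub>R x" if "x = y" for x y
    using that by (simp add: blinfun.bilinear_simps algebra_simps)
  then have "r \<notin> real_spectrum (A + c *\<^sub>R id_blinfun) \<longleftrightarrow> r - c \<notin> real_spectrum A"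
    by (simp add: not_in_real_spectrum_iff)
  then show ?thesis by blast
qed


section \<open>Continuous functional calculus\<close>

text \<open>Uniform closeness on the spectrum is closeness in operator norm. So every approximating sequence is
  Cauchy and any two have the same limit, and the definite description denotes that limit. Existence
  of one approximating sequence is what makes the limit unique.\<close>

lemma fun_calc_LIMSEQ:
  fixes A :: "'a::complex_hilbert \<Rightarrow>\<^sub>L 'a" and p :: "nat \<Rightarrow> real poly"
  assumes A: "symmetric_op A"
    and p: "uniform_limit (real_spectrum A) (\<lambda>n. poly (p n)) f sequentially"
  shows "(\<lambda>n. poly_op (p n) A) \<longlonglongrightarrow> fun_calc f A"
proof -
  have close: "\<exists>N. \<forall>m\<ge>N. \<forall>n\<ge>N. norm (poly_op (q m) A - poly_op (q' n) A) \<le> e"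
    if q: "uniform_limit (real_spectrum A) (\<lambda>n. poly (q n)) f sequentially"
      and q': "uniform_limit (real_spectrum A) (\<lambda>n. poly (q' n)) f sequentially"
      and e: "e > 0" for e and q q' :: "nat \<Rightarrow> real poly"
  proof -
    have "eventually (\<lambda>n. \<forall>r\<in>real_spectrum A. dist (poly (q n) r) (f r) < e/2) sequentially"
         "eventually (\<lambda>n. \<forall>r\<in>real_spectrum A. dist (poly (q' n) r) (f r) < e/2) sequentially"
      using q q' half_gt_zero[OF e] unfolding uniform_limit_iff by blast+
    then obtain N1 N2 where
      N: "\<And>n r. n \<ge> N1 \<Longrightarrow> r \<in> real_spectrum A \<Longrightarrow> dist (poly (q n) r) (f r) < e/2"
         "\<And>n r. n \<ge> N2 \<Longrightarrow> r \<in> real_spectrum A \<Longrightarrow> dist (poly (q' n) r) (f r) < e/2"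
      unfolding eventually_sequentially by meson
    have "norm (poly_op (q m) A - poly_op (q' n) A) \<le> e" if "m \<ge> max N1 N2" "n \<ge> max N1 N2" for m n
    proof -
      have "poly_op (q m) A - poly_op (q' n) A = poly_op (q m - q' n) A"
        by (intro blinfun_eqI) (simp add: poly_op_diff blinfun.diff_left)
      moreover have "\<bar>poly (q m - q' n) r\<bar> \<le> e" if "r \<in> real_spectrum A" for r
        using N(1)[of m r] N(2)[of n r] that \<open>m \<ge> _\<close> \<open>n \<ge> _\<close>
        by (simp add: dist_real_def abs_if split: if_splits)
      ultimately show ?thesis using norm_poly_op_le[OF A] e by simp
    qed
    then show ?thesis by blast
  qed
  have "Cauchy (\<lambda>n. poly_op (p n) A)"
  proof (rule CauchyI)
    fix e :: real assume "e > 0"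
    then show "\<exists>M. \<forall>m\<ge>M. \<forall>n\<ge>M. norm (poly_op (p m) A - poly_op (p n) A) < e"
      using close[OF p p, of "e/2"] by fastforce
  qed
  then obtain T where T: "(\<lambda>n. poly_op (p n) A) \<longlonglongrightarrow> T"
    by (auto simp: Cauchy_convergent_iff convergent_def)
  have "(\<lambda>n. poly_op (q n) A) \<longlonglongrightarrow> T"
    if q: "uniform_limit (real_spectrum A) (\<lambda>n. poly (q n)) f sequentially" for q
  proof -
    have "(\<lambda>n. poly_op (q n) A - poly_op (p n) A) \<longlonglongrightarrow> 0"
    proof (rule LIMSEQ_I)
      fix e :: real assume "e > 0"
      then show "\<exists>N. \<forall>n\<ge>N. norm (poly_op (q n) A - poly_op (p n) A - 0) < e"
        using close[OF q p, of "e/2"] by fastforce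
    qed
    from tendsto_add[OF this T] show ?thesis by simp
  qed
  then have "fun_calc f A = T"
    unfolding fun_calc_def real_spectrum_def[symmetric]
    using p T LIMSEQ_unique by (intro the_equality) blast+
  then show ?thesis using T by simp
qed

lemma fun_calc_exists_approx:
  fixes A :: "'a::complex_hilbert \<Rightarrow>\<^sub>L 'a"
  assumes "real_spectrum A \<subseteq> {a..b}" "continuous_on {a..b} f"
  obtains p :: "nat \<Rightarrow> real poly"
  where "uniform_limit (real_spectrum A) (\<lambda>n. poly (p n)) f sequentially"
proof -
  have "\<exists>p::real poly. \<forall>r\<in>{a..b}. \<bar>f r - poly p r\<bar> < inverse (real (Suc n))" for n
  proof -
    obtain g where g: "real_polynomial_function g" "\<And>x. x \<in> {a..b} \<Longrightarrow> \<bar>f x - g x\<bar> < inverse (real (Suc n))"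
      using Stone_Weierstrass_real_polynomial_function[of "{a..b}" f "inverse (real (Suc n))"] assms(2)
      by auto
    then obtain c k where "g = (\<lambda>x. \<Sum>i\<le>k. c i * x^i)"
      unfolding real_polynomial_function_iff_sum by blast
    then have "g x = poly (\<Sum>i\<le>k. monom (c i) i) x" for x
      by (simp add: poly_sum poly_monom)
    then show ?thesis using g(2) by metis
  qed
  then obtain p :: "nat \<Rightarrow> real poly"
    where p: "\<And>n r. r \<in> {a..b} \<Longrightarrow> \<bar>f r - poly (p n) r\<bar> < inverse (real (Suc n))"
    by metis
  have "uniform_limit (real_spectrum A) (\<lambda>n. poly (p n)) f sequentially"
    unfolding uniform_limit_iff
  proof (intro allI impI)
    fix e :: real assume "e > 0"
    then obtain N where N: "inverse (real (Suc N)) < e" using reals_Archimedean by blast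
    show "\<forall>\<^sub>F n in sequentially. \<forall>x\<in>real_spectrum A. dist (poly (p n) x) (f x) < e"
      unfolding eventually_sequentially
    proof (intro exI allI impI ballI)
      fix n x assume nx: "N \<le> n" "x \<in> real_spectrum A"
      have "inverse (real (Suc n)) \<le> inverse (real (Suc N))" using nx by simp
      moreover have "\<bar>f x - poly (p n) x\<bar> < inverse (real (Suc n))" using p nx assms(1) by blast
      ultimately show "dist (poly (p n) x) (f x) < e"
        using N by (simp only: dist_real_def abs_minus_commute)
    qed
  qed
  then show ?thesis using that by blast
qed

lemma fun_calc_poly: "symmetric_op A \<Longrightarrow> fun_calc (poly q) A = poly_op q A"
proof -
  assume "symmetric_op A"
  then have "(\<lambda>n::nat. poly_op q A) \<longlonglongrightarrow> fun_calc (poly q) A"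
    by (rule fun_calc_LIMSEQ[where p = "\<lambda>n. q"]) (simp add: uniform_limit_const)
  then show ?thesis by (simp add: LIMSEQ_const_iff)
qed

lemma symmetric_op_translate: "symmetric_op A \<Longrightarrow> symmetric_op (A + c *\<^sub>R id_blinfun)"
  by (simp add: symmetric_op_def blinfun.bilinear_simps inner_add_left inner_add_right)

text \<open>Substituting \<open>X + c\<close> into the approximating polynomials moves all the operators \<open>A + \<epsilon>\<close> to the
  calculus of the single operator \<open>A\<close>, where functions for different \<open>\<epsilon>\<close> can be compared.\<close>

lemma fun_calc_translate:
  assumes A: "symmetric_op A" and spec: "real_spectrum (A + c *\<^sub>R id_blinfun) \<subseteq> {a..b}"
    and f: "continuous_on {a..b} f"
  shows "fun_calc f (A + c *\<^sub>R id_blinfun) = fun_calc (\<lambda>r. f (r + c)) A"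
proof -
  let ?B = "A + c *\<^sub>R id_blinfun"
  obtain p :: "nat \<Rightarrow> real poly" where p: "uniform_limit (real_spectrum ?B) (\<lambda>n. poly (p n)) f sequentially"
    using fun_calc_exists_approx[OF spec f] .
  have "uniform_limit (real_spectrum A) (\<lambda>n. poly (p n \<circ>\<^sub>p [:c, 1:])) (\<lambda>r. f (r + c)) sequentially"
    unfolding uniform_limit_iff
  proof (intro allI impI)
    fix e :: real assume "e > 0"
    with p have "\<forall>\<^sub>F n in sequentially. \<forall>r\<in>real_spectrum ?B. dist (poly (p n) r) (f r) < e"
      unfolding uniform_limit_iff by blast
    then show "\<forall>\<^sub>F n in sequentially. \<forall>r\<in>real_spectrum A. dist (poly (p n \<circ>\<^sub>p [:c, 1:]) r) (f (r + c)) < e"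
      by eventually_elim (auto simp: real_spectrum_translate poly_pcompose add.commute)
  qed
  then have "(\<lambda>n. poly_op (p n \<circ>\<^sub>p [:c, 1:]) A) \<longlonglongrightarrow> fun_calc (\<lambda>r. f (r + c)) A"
    by (rule fun_calc_LIMSEQ[OF A])
  moreover have "poly_op (p n \<circ>\<^sub>p [:c, 1:]) A = poly_op (p n) ?B" for n
    by (intro blinfun_eqI) (rule poly_op_translate)
  moreover have "(\<lambda>n. poly_op (p n) ?B) \<longlonglongrightarrow> fun_calc f ?B"
    by (rule fun_calc_LIMSEQ[OF symmetric_op_translate[OF A] p])
  ultimately show ?thesis by (simp add: LIMSEQ_unique)
qed

lemma fun_calc_mono:
  assumes A: "symmetric_op A" and spec: "real_spectrum A \<subseteq> {a..b}"
    and f: "continuous_on {a..b} f" and g: "continuous_on {a..b} g"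
    and le: "\<And>r. r \<in> {a..b} \<Longrightarrow> f r \<le> g r"
  shows "inner (fun_calc f A x) x \<le> inner (fun_calc g A x) x"
proof -
  obtain p :: "nat \<Rightarrow> real poly" where p: "uniform_limit (real_spectrum A) (\<lambda>n. poly (p n)) f sequentially"
    using fun_calc_exists_approx[OF spec f] .
  obtain q :: "nat \<Rightarrow> real poly" where q: "uniform_limit (real_spectrum A) (\<lambda>n. poly (q n)) g sequentially"
    using fun_calc_exists_approx[OF spec g] .
  have lim: "(\<lambda>n. inner (poly_op (q n) A x) x - inner (poly_op (p n) A x) x)
      \<longlonglongrightarrow> inner (fun_calc g A x) x - inner (fun_calc f A x) x"
    by (intro tendsto_intros fun_calc_LIMSEQ[OF A] p q)
  have "- (\<eta> * (norm x)\<^sup>2) \<le> inner (fun_calc g A x) x - inner (fun_calc f A x) x" if \<eta>: "\<eta> > 0" for \<eta>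
  proof (rule tendsto_lowerbound[OF lim])
    have "\<forall>\<^sub>F n in sequentially. \<forall>r\<in>real_spectrum A. dist (poly (p n) r) (f r) < \<eta>/2"
         "\<forall>\<^sub>F n in sequentially. \<forall>r\<in>real_spectrum A. dist (poly (q n) r) (g r) < \<eta>/2"
      using p q half_gt_zero[OF \<eta>] unfolding uniform_limit_iff by blast+
    then show "\<forall>\<^sub>F n in sequentially. - (\<eta> * (norm x)\<^sup>2) \<le> inner (poly_op (q n) A x) x - inner (poly_op (p n) A x) x"
    proof eventually_elim
      case (elim n)
      have "- \<eta> * (norm x)\<^sup>2 \<le> inner (poly_op (q n - p n) A x) x"
      proof (rule poly_op_lower_bound[OF A])
        fix r assume r: "r \<in> real_spectrum A"
        then have "f r \<le> g r" using le spec by blast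
        moreover have "dist (poly (p n) r) (f r) < \<eta>/2" "dist (poly (q n) r) (g r) < \<eta>/2"
          using elim r by auto
        ultimately show "- \<eta> \<le> poly (q n - p n) r" by (simp add: dist_real_def abs_if split: if_splits)
      qed
      then show ?case by (simp add: poly_op_diff inner_diff_left)
    qed
  qed simp
  note low = this
  show ?thesis
  proof (rule ccontr)
    assume "\<not> ?thesis"
    then have d: "inner (fun_calc f A x) x - inner (fun_calc g A x) x > 0" (is "?d > 0") by simp
    have n: "(norm x)\<^sup>2 + 1 > 0" by (simp add: add_nonneg_pos)
    have "?d \<le> ?d / ((norm x)\<^sup>2 + 1) * (norm x)\<^sup>2" using low[OF divide_pos_pos[OF d n]] by linarith
    then have "?d * ((norm x)\<^sup>2 + 1) \<le> ?d * (norm x)\<^sup>2" using n by (simp add: field_simps)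
    then show False using d by (simp add: algebra_simps)
  qed
qed


section \<open>The Fujii--Seo determinant\<close>

lemma exp_ereal_nonneg: "0 \<le> exp_ereal l"
  by (simp add: exp_ereal_def)

lemma FSD_nonneg: "0 \<le> FSD u a"
  unfolding FSD_def fs_det_def by (intro INF_greatest exp_ereal_nonneg)

text \<open>The values \<open>L \<epsilon> = \<langle>ln (A + \<epsilon>) x, x\<rangle>\<close> increase with \<open>\<epsilon>\<close>, so they have an extended real limit at
  \<open>0\<close>, namely their infimum. It is at most \<open>L (c - q)\<close> with \<open>q = \<langle>A x, x\<rangle>\<close>, and the tangent of \<open>ln\<close>
  at \<open>c\<close> bounds this value by \<open>ln c\<close>.\<close>

lemma fs_det_le:
  fixes A :: "'a::complex_hilbert \<Rightarrow>\<^sub>L 'a"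
  assumes A: "symmetric_op A" and pos: "\<And>x. 0 \<le> inner (A x) x"
    and x: "norm x = 1" and c: "inner (A x) x < c"
  shows "fs_det x A \<le> ereal c"
proof -
  define q where "q = inner (A x) x"
  have q: "0 \<le> q" "q < c" using pos c by (auto simp: q_def)
  define L where "L \<epsilon> = inner (fun_calc (\<lambda>r. ln (r + \<epsilon>)) A x) x" for \<epsilon>
  have spec: "real_spectrum A \<subseteq> {0..norm A}" using real_spectrum_subset[of 0 A] pos by simp
  have cont: "continuous_on {0..norm A} (\<lambda>r. ln (r + \<epsilon>))" if "\<epsilon> > 0" for \<epsilon> :: real
    using that by (intro continuous_intros) auto
  have L: "Re (cinner (fun_calc ln (A + \<epsilon> *\<^sub>R id_blinfun) x) x) = L \<epsilon>" if \<epsilon>: "\<epsilon> > 0" for \<epsilon>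
  proof -
    have "real_spectrum (A + \<epsilon> *\<^sub>R id_blinfun) \<subseteq> {\<epsilon>..norm A + \<epsilon>}"
    proof
      fix r assume "r \<in> real_spectrum (A + \<epsilon> *\<^sub>R id_blinfun)"
      then have "r - \<epsilon> \<in> {0..norm A}" using spec by (auto simp: real_spectrum_translate)
      then show "r \<in> {\<epsilon>..norm A + \<epsilon>}" by simp
    qed
    moreover have "continuous_on {\<epsilon>..norm A + \<epsilon>} ln"
      using \<epsilon> by (intro continuous_intros) auto
    ultimately have "fun_calc ln (A + \<epsilon> *\<^sub>R id_blinfun) = fun_calc (\<lambda>r. ln (r + \<epsilon>)) A"
      by (rule fun_calc_translate[OF A])
    then show ?thesis by (simp add: L_def inner_eq_Re_cinner)
  qed
  have mono: "L \<epsilon> \<le> L \<delta>" if "0 < \<epsilon>" "\<epsilon> \<le> \<delta>" for \<epsilon> \<delta>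
    unfolding L_def using that by (intro fun_calc_mono[OF A spec] cont) auto
  have upper: "L \<epsilon> \<le> ln c" if \<epsilon>: "\<epsilon> > 0" "q + \<epsilon> \<le> c" for \<epsilon>
  proof -
    \<comment> \<open>The tangent of \<open>ln\<close> at \<open>c\<close>, shifted by \<open>\<epsilon>\<close>: \<open>r \<mapsto> ln c + (r + \<epsilon> - c) / c\<close>.\<close>
    let ?t = "[:ln c - 1 + \<epsilon> / c, 1 / c:]"
    have "L \<epsilon> \<le> inner (fun_calc (poly ?t) A x) x"
      unfolding L_def
    proof (intro fun_calc_mono[OF A spec] cont \<epsilon>)
      show "continuous_on {0..norm A} (poly ?t)" by (intro continuous_intros)
      fix r assume "r \<in> {0..norm A}"
      then have r: "(r + \<epsilon>) / c > 0" using \<epsilon> q by simp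
      have "ln (r + \<epsilon>) = ln c + ln ((r + \<epsilon>) / c)" using r q \<epsilon> by (simp add: ln_div zero_less_divide_iff)
      also have "\<dots> \<le> ln c + ((r + \<epsilon>) / c - 1)" using ln_le_minus_one[OF r] by simp
      also have "\<dots> = poly ?t r" by (simp add: add_divide_distrib)
      finally show "ln (r + \<epsilon>) \<le> poly ?t r" .
    qed
    also have "\<dots> = inner (poly_op ?t A x) x" by (simp only: fun_calc_poly[OF A])
    also have "\<dots> = ln c - 1 + (q + \<epsilon>) / c"
      using x by (simp add: blinfun.bilinear_simps inner_add_left q_def add_divide_distrib flip: power2_norm_eq_inner)
    also have "\<dots> \<le> ln c" using q \<epsilon> by simp
    finally show ?thesis .
  qed
  define l where "l = (INF \<epsilon>\<in>{0<..}. ereal (L \<epsilon>))"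
  have "((\<lambda>\<epsilon>. ereal (Re (cinner (fun_calc ln (A + \<epsilon> *\<^sub>R id_blinfun) x) x))) \<longlongrightarrow> l) (at_right 0)"
  proof (rule order_tendstoI)
    fix b assume b: "b < l"
    show "\<forall>\<^sub>F \<epsilon> in at_right 0. b < ereal (Re (cinner (fun_calc ln (A + \<epsilon> *\<^sub>R id_blinfun) x) x))"
      using eventually_at_right_less
    proof eventually_elim
      case (elim \<epsilon>)
      then have "l \<le> ereal (L \<epsilon>)" unfolding l_def by (intro INF_lower) auto
      with b L[OF elim] show ?case by simp
    qed
  next
    fix b assume "l < b"
    then obtain \<delta> where \<delta>: "\<delta> > 0" "ereal (L \<delta>) < b" unfolding l_def by (auto simp: INF_less_iff)
    have "\<forall>\<^sub>F \<epsilon> in at_right 0. \<epsilon> \<in> {0<..<\<delta>}" using \<delta>(1) by (rule eventually_at_right_real)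
    then show "\<forall>\<^sub>F \<epsilon> in at_right 0. ereal (Re (cinner (fun_calc ln (A + \<epsilon> *\<^sub>R id_blinfun) x) x)) < b"
    proof eventually_elim
      case (elim \<epsilon>)
      then have "ereal (L \<epsilon>) \<le> ereal (L \<delta>)" using mono by simp
      from le_less_trans[OF this \<delta>(2)] L[of \<epsilon>] elim show ?case by simp
    qed
  qed
  then have "fs_det x A = exp_ereal l"
    unfolding fs_det_def by (subst tendsto_Lim) auto
  moreover have "l \<le> ereal (ln c)"
    unfolding l_def using upper[of "c - q"] q by (intro INF_lower2[of "c - q"]) auto
  ultimately show ?thesis
    using q by (cases l) (auto simp: exp_ereal_def ln_ge_iff)
qed

theorem theorem4p3:
  fixes \<Omega> :: "'a::complex_hilbert set" and u :: "'a \<Rightarrow> real"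
  assumes "open \<Omega>"
    and "psh \<Omega> (\<lambda>z. ereal (u z))"
    and "C2_on \<Omega> u"
    and "maximal_psh \<Omega> (\<lambda>z. ereal (u z))"
  shows "\<forall>a\<in>\<Omega>. FSD u a = 0"
proof
  fix a assume a: "a \<in> \<Omega>"
  have "FSD u a \<le> ereal c" if c: "c > 0" for c
  proof -
    obtain x where x: "norm x = 1" "inner (levi_op u a x) x < c"
      using maximal_psh_levi_op_not_coercive[OF assms(1,3,4) a c] by blast
    have "fs_det x (levi_op u a) \<le> ereal c"
    proof (rule fs_det_le)
      show "symmetric_op (levi_op u a)"
        unfolding symmetric_op_def using symmetric_levi_op[OF assms(1,3) a] by blast
      show "0 \<le> inner (levi_op u a y) y" for y
        by (rule psh_C2_levi_op_nonneg[OF assms(1,2,3) a])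
    qed (use x in auto)
    moreover have "FSD u a \<le> fs_det x (levi_op u a)"
      unfolding FSD_def by (rule INF_lower) (simp add: x(1))
    ultimately show ?thesis by (rule order_trans[rotated])
  qed
  then have "FSD u a \<le> 0" by (rule ereal_le_epsilon2[of _ 0, simplified])
  then show "FSD u a = 0" using FSD_nonneg[of u a] by (rule antisym)
qed

end
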